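(* For any $\lambda>0$ and any $\delta\in(0,1)$, with probability at least $1-\delta$, $$d_K\Big(\frac{\hat u_{\rm MLE}}{\hat\sigma_{\rm MLE}},\frac{u^*}{\sigma^*}\Big)\le L\bar c\,\mu_N+\frac{\sqrt{\frac{R_D+2\sqrt{-R_D\log\delta}-2\log\delta}{\omega^2K}}+\sqrt{\frac{R_D+2\sqrt{-R_D\log\delta}-2\log\delta}{\omega^2K}+\lambda\big(\bar c\sqrt{N-1}\big)^2}}{\sqrt{\lambda_{\min}(\Sigma_D+\lambda\mathbf{I})}},$$ where $d_K(u,\tilde u):=\sup_{y\in[y_1,y_N]}|u(y)-\tilde u(y)|$, $\mu_N:=\max_{j=2,\dots,N}(y_j-y_{j-1})$, $\Sigma_D=\frac1KP^\top P\in\mathbb{R}^{(N-1)\times(N-1)}$, $R_D=\mathrm{rank}(\Sigma_D)$, $\omega=\frac{1}{2+2\exp(2\bar c)}$ and $\lambda_{\min}$ denotes the minimum eigenvalue.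
   Context: Fix constants $\bar b>0$, $L>0$, $\bar c>0$. $\mathcal{U}_c$ is the set of all functions $u:[0,\bar b]\to\mathbb{R}$ that are monotonically increasing (in the weak sense, i.e. nondecreasing), concave, Lipschitz continuous with modulus at most $L$, and satisfy $u(0)=0$, $u(\bar b)=1$. Data and model: $(W_k,Y_k)$, $k=1,\dots,K$, are given (non-random) pairs of lotteries, each lottery having finite support in $[0,\bar b]$. There are a true utility function $u^*\in\mathcal{U}_c$ and a true scale parameter $\sigma^*\ge1/\bar c$ such that the response is $Z_k=1$ if $\mathbb{E}[u^*(W_k)]+\varepsilon_{1k}\ge\mathbb{E}[u^*(Y_k)]+\varepsilon_{2k}$ and $Z_k=-1$ otherwise, where all $\varepsilon_{1k},\varepsilon_{2k}$ are i.i.d. $\mathrm{Gumbel}(0,\sigma^* )$ (CDF $e^{-e^{-x/\sigma^*}}$). Thus the $Z_k$ are independent with $\mathbb{P}(Z_k=1)=1/\big(1+\exp(-(\mathbb{E}[u^*(W_k)]-\mathbb{E}[u^*(Y_k)])/\sigma^* )\big)$; probability refers to the randomness of $(Z_1,\dots,Z_K)$. Let $\{y_1<\dots<y_N\}$ be the ordered list of all points of $\{0,\bar b\}\cup\bigcup_k \mathrm{supp}(W_k)\cup\bigcup_k\mathrm{supp}(Y_k)$ ($y_1=0$, $y_N=\bar b$). Put $p^k_j=\mathbb{P}[W_k=y_j]-\mathbb{P}[Y_k=y_j]$, $p^k_{2:N}=(p^k_2,\dots,p^k_N)^\top$, and let $P\in\mathbb{R}^{K\times(N-1)}$ have $k$-th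 row $(p^k_{2:N})^\top$. MLE: let $(\bar\alpha^*,\bar\beta^*,\gamma^* )$ be an optimal solution of: maximize $-\sum_{k}\log\big[1+\exp\big(\sum_{j=1}^N -Z_kp^k_j\bar\alpha_j\big)\big]$ over $\bar\alpha\in\mathbb{R}^N$, $\bar\beta\in\mathbb{R}^{N-1}$, $\gamma\in[0,\bar c]$ subject to $\bar\beta_j=(\bar\alpha_{j+1}-\bar\alpha_j)/(y_{j+1}-y_j)$ ($1\le j\le N-1$), $\bar\beta_{j+1}\le\bar\beta_j$ ($1\le j\le N-2$), $\bar\beta_1\le L\gamma$, $\bar\beta_{N-1}\ge0$, $\bar\alpha_1=0$, $\bar\alpha_N=\gamma$. Set $\hat\sigma_{\rm MLE}=1/\gamma^*$, and let $\hat u_{\rm MLE}$ be the continuous function on $[0,\bar b]$ that is affine on each $[y_j,y_{j+1}]$ with $\hat u_{\rm MLE}(y_j)=\bar\alpha^*_j/\gamma^*$. Thus $\hat u_{\rm MLE}/\hat\sigma_{\rm MLE}$ is the piecewise-linear interpolant of the values $\bar\alpha^*_j$ at $y_j$; if $\gamma^*=0$ (where $\hat\sigma_{\rm MLE}=+\infty$ and $\bar\alpha^*=0$), it is read as the zero function. *)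

theory Defs
  imports
    "HOL-Probability.Probability"
    "Jordan_Normal_Form.DL_Rank"
    "Jordan_Normal_Form.Spectral_Radius"
begin

definition utility_class :: "real \<Rightarrow> real \<Rightarrow> (real \<Rightarrow> real) set" where
  "utility_class b L =
    {u. mono_on {0..b} u \<and> concave_on {0..b} u \<and> L-lipschitz_on {0..b} u \<and> u 0 = 0 \<and> u b = 1}"

definition gumbel_cdf :: "real \<Rightarrow> real \<Rightarrow> real \<Rightarrow> real" where
  "gumbel_cdf m s x = exp (- exp (- (x - m) / s))"

text \<open>The response to the \<open>k\<close>-th question, with additive noise \<open>\<epsilon> 1 k\<close> on the
  utility of \<open>W k\<close> and \<open>\<epsilon> 2 k\<close> on that of \<open>Y k\<close>.\<close>

definition response ::
  "(real \<Rightarrow> real) \<Rightarrow> (nat \<Rightarrow> real pmf) \<Rightarrow> (nat \<Rightarrow> real pmf) \<Rightarrow> (nat \<Rightarrow> nat \<Rightarrow> 'a \<Rightarrow> real)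
    \<Rightarrow> 'a \<Rightarrow> nat \<Rightarrow> real" where
  "response u W Y \<epsilon> x k =
    (if measure_pmf.expectation (W k) u + \<epsilon> 1 k x \<ge> measure_pmf.expectation (Y k) u + \<epsilon> 2 k x
     then 1 else - 1)"

definition breakpoints ::
  "real \<Rightarrow> nat \<Rightarrow> (nat \<Rightarrow> real pmf) \<Rightarrow> (nat \<Rightarrow> real pmf) \<Rightarrow> real set" where
  "breakpoints b K W Y = {0, b} \<union> (\<Union>k\<in>{1..K}. set_pmf (W k)) \<union> (\<Union>k\<in>{1..K}. set_pmf (Y k))"

text \<open>Indices of breakpoints start at 1: \<open>nth_point S 1 < \<dots> < nth_point S (card S)\<close>.\<close>

definition nth_point :: "real set \<Rightarrow> nat \<Rightarrow> real" where
  "nth_point S j = sorted_list_of_set S ! (j - 1)"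

definition mesh :: "nat \<Rightarrow> (nat \<Rightarrow> real) \<Rightarrow> real" where
  "mesh N y = Max ((\<lambda>j. y j - y (j - 1)) ` {2..N})"

definition prob_diff ::
  "(nat \<Rightarrow> real pmf) \<Rightarrow> (nat \<Rightarrow> real pmf) \<Rightarrow> (nat \<Rightarrow> real) \<Rightarrow> nat \<Rightarrow> nat \<Rightarrow> real" where
  "prob_diff W Y y k j = pmf (W k) (y j) - pmf (Y k) (y j)"

text \<open>Matrix indices start at 0, so entry \<open>(i, j)\<close> is \<open>p (i + 1) (j + 2)\<close>: the first
  breakpoint is left out.\<close>

definition design_matrix :: "nat \<Rightarrow> nat \<Rightarrow> (nat \<Rightarrow> nat \<Rightarrow> real) \<Rightarrow> real mat" where
  "design_matrix K N p = Matrix.mat K (N - 1) (\<lambda>(i, j). p (i + 1) (j + 2))"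

definition Sigma_D :: "nat \<Rightarrow> nat \<Rightarrow> (nat \<Rightarrow> nat \<Rightarrow> real) \<Rightarrow> real mat" where
  "Sigma_D K N p = (1 / real K) \<cdot>\<^sub>m (transpose_mat (design_matrix K N p) * design_matrix K N p)"

text \<open>The minimum ranges over real eigenvalues, which are all the eigenvalues of the symmetric
  matrices it is applied to.\<close>

definition min_eigenvalue :: "real mat \<Rightarrow> real" where
  "min_eigenvalue A = Min (spectrum A)"

definition log_likelihood ::
  "nat \<Rightarrow> nat \<Rightarrow> (nat \<Rightarrow> nat \<Rightarrow> real) \<Rightarrow> (nat \<Rightarrow> real) \<Rightarrow> (nat \<Rightarrow> real) \<Rightarrow> real" where
  "log_likelihood K N p z \<alpha> = - (\<Sum>k=1..K. ln (1 + exp (\<Sum>j=1..N. - z k * p k j * \<alpha> j)))"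

text \<open>Vectors are functions on \<open>nat\<close>: only the values of \<open>\<alpha>\<close> on \<open>{1..N}\<close> and of \<open>\<beta>\<close> on
  \<open>{1..N - 1}\<close> matter.\<close>

definition mle_feasible ::
  "nat \<Rightarrow> (nat \<Rightarrow> real) \<Rightarrow> real \<Rightarrow> real \<Rightarrow> (nat \<Rightarrow> real) \<Rightarrow> (nat \<Rightarrow> real) \<Rightarrow> real \<Rightarrow> bool" where
  "mle_feasible N y L c \<alpha> \<beta> \<gamma> \<longleftrightarrow>
    0 \<le> \<gamma> \<and> \<gamma> \<le> c \<and>
    (\<forall>j\<in>{1..N - 1}. \<beta> j = (\<alpha> (j + 1) - \<alpha> j) / (y (j + 1) - y j)) \<and>
    (\<forall>j\<in>{1..N - 2}. \<beta> (j + 1) \<le> \<beta> j) \<and>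
    \<beta> 1 \<le> L * \<gamma> \<and> \<beta> (N - 1) \<ge> 0 \<and> \<alpha> 1 = 0 \<and> \<alpha> N = \<gamma>"

definition mle_optimal ::
  "nat \<Rightarrow> nat \<Rightarrow> (nat \<Rightarrow> real) \<Rightarrow> (nat \<Rightarrow> nat \<Rightarrow> real) \<Rightarrow> real \<Rightarrow> real \<Rightarrow> (nat \<Rightarrow> real)
    \<Rightarrow> (nat \<Rightarrow> real) \<Rightarrow> (nat \<Rightarrow> real) \<Rightarrow> real \<Rightarrow> bool" where
  "mle_optimal K N y p L c z \<alpha> \<beta> \<gamma> \<longleftrightarrow>
    is_arg_max (\<lambda>(\<alpha>, \<beta>, \<gamma>). log_likelihood K N p z \<alpha>)
      (\<lambda>(\<alpha>, \<beta>, \<gamma>). mle_feasible N y L c \<alpha> \<beta> \<gamma>) (\<alpha>, \<beta>, \<gamma>)"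

text \<open>Piecewise linear interpolation on \<open>[y 1, y N]\<close> of the values \<open>v j\<close> at \<open>y j\<close>, where
  \<open>2 \<le> N\<close> and \<open>y\<close> is strictly increasing on \<open>{1..N}\<close>.\<close>

definition pl_interp :: "nat \<Rightarrow> (nat \<Rightarrow> real) \<Rightarrow> (nat \<Rightarrow> real) \<Rightarrow> real \<Rightarrow> real" where
  "pl_interp N y v x =
    (let j = Max {j\<in>{1..N - 1}. y j \<le> x}
     in v j + (v (j + 1) - v j) / (y (j + 1) - y j) * (x - y j))"

lemma pl_interp_segment:
  assumes "strict_mono_on {1..N} y" "j \<in> {1..N - 1}" "x \<in> {y j..y (j + 1)}"
  shows "pl_interp N y v x = v j + (v (j + 1) - v j) / (y (j + 1) - y j) * (x - y j)"
proof -
  have less: "y i < y k" if "1 \<le> i" "i < k" "k \<le> N" for i k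
    using strict_mono_onD[OF assms(1)] that by auto
  have *: "Max {i\<in>{1..N - 1}. y i \<le> x} = m"
    if "m \<in> {1..N - 1}" "y m \<le> x" "\<And>i. m < i \<Longrightarrow> i \<le> N - 1 \<Longrightarrow> x < y i" for m
  proof (rule Max_eqI)
    show "finite {i\<in>{1..N - 1}. y i \<le> x}"
      by simp
  qed (use that in \<open>auto simp: not_less[symmetric]\<close>)
  show ?thesis
  proof (cases "x = y (j + 1) \<and> j + 1 \<le> N - 1")
    case True
    have "Max {i\<in>{1..N - 1}. y i \<le> x} = j + 1"
      using True less by (intro *) auto
    moreover have "y j < y (j + 1)"
      using assms(2) by (intro less) auto
    ultimately show ?thesis
      using True by (simp add: pl_interp_def)
  next
    case False
    have "Max {i\<in>{1..N - 1}. y i \<le> x} = j"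
    proof (rule *)
      fix i assume i: "j < i" "i \<le> N - 1"
      then have "x < y (j + 1)"
        using False assms(3) by auto
      also have "y (j + 1) \<le> y i"
        using i less[of "j + 1" i] by (cases "i = j + 1") (auto intro: less_imp_le)
      finally show "x < y i" .
    qed (use assms in auto)
    then show ?thesis
      by (simp add: pl_interp_def)
  qed
qed

definition sigma_MLE :: "real \<Rightarrow> real" where
  "sigma_MLE \<gamma> = 1 / \<gamma>"

definition u_MLE :: "nat \<Rightarrow> (nat \<Rightarrow> real) \<Rightarrow> (nat \<Rightarrow> real) \<Rightarrow> real \<Rightarrow> real \<Rightarrow> real" where
  "u_MLE N y \<alpha> \<gamma> = pl_interp N y (\<lambda>j. \<alpha> j / \<gamma>)"

text \<open>The case \<open>\<gamma> = 0\<close> stands for an infinite scale estimate.\<close>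

definition scaled_u_MLE :: "nat \<Rightarrow> (nat \<Rightarrow> real) \<Rightarrow> (nat \<Rightarrow> real) \<Rightarrow> real \<Rightarrow> real \<Rightarrow> real" where
  "scaled_u_MLE N y \<alpha> \<gamma> x = (if \<gamma> = 0 then 0 else u_MLE N y \<alpha> \<gamma> x / sigma_MLE \<gamma>)"

definition d_K :: "nat \<Rightarrow> (nat \<Rightarrow> real) \<Rightarrow> (real \<Rightarrow> real) \<Rightarrow> (real \<Rightarrow> real) \<Rightarrow> real" where
  "d_K N y u u' = (SUP x\<in>{y 1..y N}. \<bar>u x - u' x\<bar>)"

end

theory Submission
  imports Defs
begin

text \<open>Let \<open>\<Delta>\<close> be the difference of the estimated and the true node values and \<open>x = P \<Delta>\<close>. Since the
  true parameters are feasible and the logistic loss is \<open>\<omega>\<close>-strongly convex on the relevant range,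
  optimality gives \<open>\<omega> / 2 * \<bar>x\<bar>\<^sup>2 \<le> \<langle>V, x\<rangle>\<close> with a vector \<open>V\<close> of independent centered Bernoulli variables.
  Projecting \<open>V\<close> on the column space of \<open>P\<close>, which has an orthonormal basis of at most \<open>R\<close> vectors,
  yields \<open>\<bar>x\<bar>\<^sup>2 \<le> 4 Q / \<omega>\<^sup>2\<close>, where \<open>Q\<close> is the squared norm of the projection. Hoeffding's lemma and
  \<open>exp (a\<^sup>2) = E exp (sqrt 2 * a * g)\<close> for a standard Gaussian \<open>g\<close>, applied to one basis vector after the
  other, give \<open>E exp Q \<le> sqrt 2 ^ R\<close>, hence the tail bound for \<open>Q\<close>. The constants leave room: the
  factor 4 is absorbed by \<open>sqrt (4 * a + b) \<le> sqrt a + sqrt (a + b)\<close>. Finally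
  \<open>\<lambda>\<^sub>m\<^sub>i\<^sub>n * \<bar>\<Delta>\<bar>\<^sup>2 \<le> \<bar>x\<bar>\<^sup>2 / K + \<lambda> * \<bar>\<Delta>\<bar>\<^sup>2\<close> bounds the error at the nodes.\<close>

subsection \<open>Exponential moments\<close>

text \<open>Hoeffding's lemma for a centered Bernoulli variable of mean \<open>p\<close>: its two
  values are at distance 1, whence the constant 1/8.\<close>

lemma bernoulli_exp_moment_le:
  fixes p h :: real
  assumes "0 \<le> p" "p \<le> 1"
  shows "p * exp (h * (1 - p)) + (1 - p) * exp (- (h * p)) \<le> exp (h\<^sup>2 / 8)"
proof -
  have *: "q * exp (t * (1 - q)) + (1 - q) * exp (- (t * q)) \<le> exp (t\<^sup>2 / 8)"
    if "0 \<le> q" "q \<le> 1" "0 \<le> t" for q t :: real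
  proof -
    have pos: "0 < 1 + q * (exp t - 1)"
      using that by (simp add: add_pos_nonneg)
    have "q * exp (t * (1 - q)) + (1 - q) * exp (- (t * q)) = exp (- t * q) * (1 + q * (exp t - 1))"
      by (simp add: algebra_simps exp_diff exp_minus divide_inverse)
    also have "\<dots> = exp (- t * q + ln (1 + q * (exp t - 1)))"
      unfolding exp_add using pos by simp
    also have "\<dots> \<le> exp (t\<^sup>2 / 8)"
      using Hoeffdings_lemma_aux[OF that(3,1)] by simp
    finally show ?thesis .
  qed
  \<comment> \<open>The left side is unchanged when \<open>p\<close> and \<open>h\<close> become
    \<open>1 - p\<close> and \<open>- h\<close>, so negative \<open>h\<close> reduces to nonnegative
    \<open>t\<close>.\<close>
  show ?thesis
    using *[of p h] *[of "1 - p" "- h"] assms by (cases "0 \<le> h") auto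
qed

text \<open>Completing the square gives a multiple of the density of mean \<open>a\<close>. At
  \<open>sqrt 2 * a\<close> the value is \<open>exp (a\<^sup>2)\<close>, which is how a squared
  exponent gets linearised.\<close>

lemma has_bochner_integral_normal_density_exp_linear:
  "has_bochner_integral lborel (\<lambda>g. normal_density 0 1 g * exp (a * g)) (exp (a\<^sup>2 / 2))"
proof -
  have "normal_density 0 1 g * exp (a * g) = exp (a\<^sup>2 / 2) * normal_density a 1 g" for g :: real
    by (simp add: normal_density_def exp_add[symmetric] power2_eq_square field_simps)
  moreover have "has_bochner_integral lborel (normal_density a 1) 1"
    by (simp add: has_bochner_integral_iff)
  then have "has_bochner_integral lborel (\<lambda>g. exp (a\<^sup>2 / 2) * normal_density a 1 g) (exp (a\<^sup>2 / 2) * 1)"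
    by (rule has_bochner_integral_mult_right)
  ultimately show ?thesis
    by simp
qed

text \<open>The exponents combine to \<open>- g\<^sup>2 / 4\<close>, a Gaussian of variance 2. The
  factor \<open>sqrt 2\<close> from its normalisation is the price of one basis vector.\<close>

lemma has_bochner_integral_normal_density_exp_square:
  "has_bochner_integral lborel (\<lambda>g. normal_density 0 1 g * exp (g\<^sup>2 / 4)) (sqrt 2)"
proof -
  have "normal_density 0 1 g * exp (g\<^sup>2 / 4) = sqrt 2 * normal_density 0 (sqrt 2) g" for g :: real
    by (simp add: normal_density_def exp_add[symmetric] power2_eq_square field_simps real_sqrt_mult)
  moreover have "has_bochner_integral lborel (normal_density 0 (sqrt 2)) 1"
    by (simp add: has_bochner_integral_iff)
  then have "has_bochner_integral lborel (\<lambda>g. sqrt 2 * normal_density 0 (sqrt 2) g) (sqrt 2 * 1)"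
    by (rule has_bochner_integral_mult_right)
  ultimately show ?thesis
    by simp
qed

text \<open>The linear term \<open>w\<close> is what the Gaussian linearisation of one square feeds into the
  induction over the remaining ones.\<close>

lemma exp_moment_projection_le:
  fixes q :: "'z \<Rightarrow> real" and V :: "'z \<Rightarrow> 'k \<Rightarrow> real" and e :: "nat \<Rightarrow> 'k \<Rightarrow> real"
  assumes "\<And>z. z \<in> Z \<Longrightarrow> 0 \<le> q z"
    and subgaussian: "\<And>w. (\<Sum>z\<in>Z. q z * exp (\<Sum>k\<in>I. w k * V z k)) \<le> exp ((\<Sum>k\<in>I. (w k)\<^sup>2) / 8)"
    and "\<And>i j. i < r \<Longrightarrow> j < r \<Longrightarrow> (\<Sum>k\<in>I. e i k * e j k) = of_bool (i = j)"
    and "\<And>i. i < r \<Longrightarrow> (\<Sum>k\<in>I. w k * e i k) = 0"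
  shows "(\<Sum>z\<in>Z. q z * exp ((\<Sum>k\<in>I. w k * V z k) + (\<Sum>i<r. (\<Sum>k\<in>I. e i k * V z k)\<^sup>2)))
           \<le> sqrt 2 ^ r * exp ((\<Sum>k\<in>I. (w k)\<^sup>2) / 8)"
  using assms(3,4)
proof (induction r arbitrary: w)
  case 0
  show ?case
    using subgaussian[of w] by simp
next
  case (Suc r)
  define a where "a z = (\<Sum>k\<in>I. e r k * V z k)" for z
  define B where "B z = (\<Sum>k\<in>I. w k * V z k) + (\<Sum>i<r. (\<Sum>k\<in>I. e i k * V z k)\<^sup>2)" for z
  \<comment> \<open>For fixed \<open>g\<close> the linearised square of \<open>a z\<close> is one
    more linear term, along \<open>e r\<close>, and is absorbed into the weight.\<close>
  define w' where "w' g k = w k + sqrt 2 * g * e r k" for g k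
  have w'_V: "(\<Sum>k\<in>I. w' g k * V z k) = (\<Sum>k\<in>I. w k * V z k) + sqrt 2 * a z * g" for g z
    by (simp add: w'_def a_def algebra_simps sum.distrib sum_distrib_left)
  have w'_e: "(\<Sum>k\<in>I. w' g k * e i k) = 0" if "i < r" for g i
  proof -
    have "(\<Sum>k\<in>I. w' g k * e i k) = (\<Sum>k\<in>I. w k * e i k) + sqrt 2 * g * (\<Sum>k\<in>I. e r k * e i k)"
      by (simp add: w'_def algebra_simps sum.distrib sum_distrib_left)
    then show ?thesis
      using Suc.prems that by simp
  qed
  \<comment> \<open>Orthogonality of \<open>w\<close> and \<open>e r\<close> kills the cross term.
    The surplus \<open>2 * g\<^sup>2\<close>, divided by 8, is the exponent integrated in
    \<open>quad\<close>.\<close>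
  have w'_norm: "(\<Sum>k\<in>I. (w' g k)\<^sup>2) = (\<Sum>k\<in>I. (w k)\<^sup>2) + 2 * g\<^sup>2" for g
  proof -
    have "(\<Sum>k\<in>I. (w' g k)\<^sup>2) = (\<Sum>k\<in>I. (w k)\<^sup>2) + 2 * sqrt 2 * g * (\<Sum>k\<in>I. w k * e r k)
        + 2 * g\<^sup>2 * (\<Sum>k\<in>I. e r k * e r k)"
      by (simp add: w'_def power2_eq_square algebra_simps sum.distrib sum_distrib_left)
    then show ?thesis
      using Suc.prems by simp
  qed
  have lin: "has_bochner_integral lborel
      (\<lambda>g. \<Sum>z\<in>Z. q z * exp (B z) * (normal_density 0 1 g * exp (sqrt 2 * a z * g)))
      (\<Sum>z\<in>Z. q z * exp (B z) * exp ((sqrt 2 * a z)\<^sup>2 / 2))"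
    by (intro has_bochner_integral_sum has_bochner_integral_mult_right
        has_bochner_integral_normal_density_exp_linear)
  have quad: "has_bochner_integral lborel
      (\<lambda>g. sqrt 2 ^ r * exp ((\<Sum>k\<in>I. (w k)\<^sup>2) / 8) * (normal_density 0 1 g * exp (g\<^sup>2 / 4)))
      (sqrt 2 ^ r * exp ((\<Sum>k\<in>I. (w k)\<^sup>2) / 8) * sqrt 2)"
    by (intro has_bochner_integral_mult_right has_bochner_integral_normal_density_exp_square)
  have "(\<Sum>z\<in>Z. q z * exp (B z) * exp ((sqrt 2 * a z)\<^sup>2 / 2))
      \<le> sqrt 2 ^ r * exp ((\<Sum>k\<in>I. (w k)\<^sup>2) / 8) * sqrt 2"
  unfolding has_bochner_integral_integral_eq[OF lin, symmetric]
      has_bochner_integral_integral_eq[OF quad, symmetric]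
  \<comment> \<open>The induction hypothesis is used at each \<open>g\<close> with the weight
    \<open>w' g\<close> and then integrated against the normal density.\<close>
  proof (rule integral_mono)
    fix g :: real
    have "(\<Sum>z\<in>Z. q z * exp (B z + sqrt 2 * a z * g))
        \<le> sqrt 2 ^ r * exp ((\<Sum>k\<in>I. (w' g k)\<^sup>2) / 8)"
      using Suc.IH[of "w' g"] Suc.prems w'_e by (simp add: w'_V B_def add_ac)
    also have "\<dots> = sqrt 2 ^ r * exp ((\<Sum>k\<in>I. (w k)\<^sup>2) / 8) * exp (g\<^sup>2 / 4)"
      by (simp add: w'_norm exp_add[symmetric] add_divide_distrib)
    finally have "normal_density 0 1 g * (\<Sum>z\<in>Z. q z * exp (B z + sqrt 2 * a z * g))
        \<le> normal_density 0 1 g * (sqrt 2 ^ r * exp ((\<Sum>k\<in>I. (w k)\<^sup>2) / 8) * exp (g\<^sup>2 / 4))"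
      by (intro mult_left_mono) auto
    then show "(\<Sum>z\<in>Z. q z * exp (B z) * (normal_density 0 1 g * exp (sqrt 2 * a z * g)))
        \<le> sqrt 2 ^ r * exp ((\<Sum>k\<in>I. (w k)\<^sup>2) / 8) * (normal_density 0 1 g * exp (g\<^sup>2 / 4))"
      by (simp add: sum_distrib_left exp_add mult_ac)
  qed (use lin quad in \<open>simp_all only: has_bochner_integral_iff\<close>)
  then show ?case
    by (simp add: B_def a_def exp_add power_mult_distrib mult_ac add.assoc[symmetric])
qed

section \<open>Gram-Schmidt orthonormalisation\<close>

lemma sum_mult_sum_swap:
  fixes f :: "'k \<Rightarrow> real"
  shows "(\<Sum>k\<in>I. f k * (\<Sum>i\<in>A. c i * e i k)) = (\<Sum>i\<in>A. c i * (\<Sum>k\<in>I. e i k * f k))"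
  unfolding sum_distrib_left by (subst sum.swap) (simp add: mult_ac)

text \<open>Gram-Schmidt, one vector at a time. A vector already in the span leaves the family as it
  is, hence only an inequality for \<open>r\<close>.\<close>

lemma orthonormal_spanning_family:
  fixes v :: "'j \<Rightarrow> 'k \<Rightarrow> real"
  assumes "finite J" "finite I"
  shows "\<exists>r e. r \<le> card J \<and>
    (\<forall>i<r. \<forall>j<r. (\<Sum>k\<in>I. e i k * e j k) = of_bool (i = j)) \<and>
    (\<forall>j\<in>J. \<forall>k\<in>I. v j k = (\<Sum>i<r. (\<Sum>l\<in>I. e i l * v j l) * e i k))"
  using assms(1)
proof induction
  case empty
  show ?case
    by (intro exI[of _ 0]) auto
next
  case (insert j0 J)
  then obtain r and e :: "nat \<Rightarrow> 'k \<Rightarrow> real" where r: "r \<le> card J"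
    and e: "\<And>i j. i < r \<Longrightarrow> j < r \<Longrightarrow> (\<Sum>k\<in>I. e i k * e j k) = of_bool (i = j)"
    and span: "\<And>j k. j \<in> J \<Longrightarrow> k \<in> I \<Longrightarrow> v j k = (\<Sum>i<r. (\<Sum>l\<in>I. e i l * v j l) * e i k)"
    by blast
  \<comment> \<open>Residual of \<open>v j0\<close> after projection on the family found so
    far.\<close>
  define w where "w k = v j0 k - (\<Sum>i<r. (\<Sum>l\<in>I. e i l * v j0 l) * e i k)" for k
  define n where "n = sqrt (\<Sum>k\<in>I. (w k)\<^sup>2)"
  have we: "(\<Sum>k\<in>I. e j k * w k) = 0" if "j < r" for j
  proof -
    have "(\<Sum>k\<in>I. e j k * w k) = (\<Sum>k\<in>I. e j k * v j0 k)
        - (\<Sum>k\<in>I. e j k * (\<Sum>i<r. (\<Sum>l\<in>I. e i l * v j0 l) * e i k))"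
      unfolding w_def right_diff_distrib sum_subtractf ..
    also have "(\<Sum>k\<in>I. e j k * (\<Sum>i<r. (\<Sum>l\<in>I. e i l * v j0 l) * e i k))
        = (\<Sum>i<r. (\<Sum>l\<in>I. e i l * v j0 l) * (\<Sum>k\<in>I. e i k * e j k))"
      by (rule sum_mult_sum_swap)
    also have "\<dots> = (\<Sum>i<r. if i = j then (\<Sum>l\<in>I. e i l * v j0 l) else 0)"
      using e that by (intro sum.cong) auto
    finally show ?thesis
      using that by simp
  qed
  show ?case
  proof (cases "n = 0")
    case True
    then have "\<forall>k\<in>I. w k = 0"
      using assms(2) by (simp add: n_def sum_nonneg_eq_0_iff)
    then have "v j0 k = (\<Sum>i<r. (\<Sum>l\<in>I. e i l * v j0 l) * e i k)" if "k \<in> I" for k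
      using w_def[of k] bspec[OF _ that, of "\<lambda>k. w k = 0"] by linarith
    with span have "v j k = (\<Sum>i<r. (\<Sum>l\<in>I. e i l * v j l) * e i k)"
      if "j \<in> insert j0 J" "k \<in> I" for j k
      using that by blast
    moreover have "r \<le> card (insert j0 J)"
      using r insert.hyps by simp
    ultimately show ?thesis
      using e by (intro exI[of _ r] exI[of _ e]) blast
  next
    case False
    have n2: "(\<Sum>k\<in>I. w k * w k) = n * n"
      by (simp add: n_def sum_nonneg power2_eq_square)
    define e' where "e' i = (if i < r then e i else (\<lambda>k. w k / n))" for i
    have orth: "(\<Sum>k\<in>I. e i k * (w k / n)) = 0" if "i < r" for i
      using we[OF that] by (simp add: sum_divide_distrib[symmetric])
    have unit: "(\<Sum>k\<in>I. w k / n * (w k / n)) = 1"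
      using n2 False by (simp add: sum_divide_distrib[symmetric])
    have e'_orth: "(\<Sum>k\<in>I. e' i k * e' j k) = of_bool (i = j)" if "i < Suc r" "j < Suc r" for i j
    proof -
      consider "i < r" "j < r" | "i < r" "j = r" | "i = r" "j < r" | "i = r" "j = r"
        using \<open>i < Suc r\<close> \<open>j < Suc r\<close> unfolding less_Suc_eq by blast
      then show ?thesis
      proof cases
        case 3
        have "(\<Sum>k\<in>I. e' i k * e' j k) = (\<Sum>k\<in>I. e j k * (w k / n))"
          using 3 by (intro sum.cong) (auto simp: e'_def)
        then show ?thesis
          using orth 3 by simp
      qed (use e orth unit in \<open>auto simp: e'_def\<close>)
    qed
    \<comment> \<open>The residual is orthogonal to the projection of \<open>v j0\<close>, so its
      inner product with \<open>v j0\<close> is its own squared norm \<open>n * n\<close>.\<close>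
    have v_j0: "(\<Sum>l\<in>I. w l / n * v j0 l) = n"
    proof -
      have "(\<Sum>l\<in>I. w l * v j0 l) = (\<Sum>l\<in>I. w l * w l)
          + (\<Sum>l\<in>I. w l * (\<Sum>i<r. (\<Sum>m\<in>I. e i m * v j0 m) * e i l))"
        unfolding sum.distrib[symmetric] distrib_left[symmetric] by (simp add: w_def)
      also have "(\<Sum>l\<in>I. w l * (\<Sum>i<r. (\<Sum>m\<in>I. e i m * v j0 m) * e i l))
          = (\<Sum>i<r. (\<Sum>m\<in>I. e i m * v j0 m) * (\<Sum>l\<in>I. e i l * w l))"
        by (rule sum_mult_sum_swap)
      also have "\<dots> = 0"
        using we by simp
      finally show ?thesis
        using n2 False by (simp add: sum_divide_distrib[symmetric])
    qed
    have v_J: "(\<Sum>l\<in>I. w l / n * v j l) = 0" if "j \<in> J" for j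
    proof -
      have "(\<Sum>l\<in>I. w l * v j l) = (\<Sum>l\<in>I. w l * (\<Sum>i<r. (\<Sum>m\<in>I. e i m * v j m) * e i l))"
        by (intro sum.cong refl arg_cong2[where f = "(*)"] span[OF that])
      also have "\<dots> = (\<Sum>i<r. (\<Sum>m\<in>I. e i m * v j m) * (\<Sum>l\<in>I. e i l * w l))"
        by (rule sum_mult_sum_swap)
      also have "\<dots> = 0"
        using we by simp
      finally show ?thesis
        by (simp add: sum_divide_distrib[symmetric])
    qed
    have split: "(\<Sum>i<Suc r. (\<Sum>l\<in>I. e' i l * v j l) * e' i k)
        = (\<Sum>i<r. (\<Sum>l\<in>I. e i l * v j l) * e i k) + (\<Sum>l\<in>I. w l / n * v j l) * (w k / n)" for j k
      by (simp add: e'_def)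
    have "v j k = (\<Sum>i<Suc r. (\<Sum>l\<in>I. e' i l * v j l) * e' i k)"
      if "j \<in> insert j0 J" "k \<in> I" for j k
    proof (cases "j \<in> J")
      case True
      then show ?thesis
        unfolding split v_J[OF True] using span[OF True that(2)] by linarith
    next
      case F: False
      then have j: "j = j0"
        using that by simp
      show ?thesis
        unfolding split j v_j0 using False w_def[of k] by simp
    qed
    moreover have "Suc r \<le> card (insert j0 J)"
      using r insert.hyps by simp
    ultimately show ?thesis
      using e'_orth by (intro exI[of _ "Suc r"] exI[of _ e']) blast
  qed
qed

text \<open>Chernoff bound with parameter 1. The summand is the probability of the response pattern
  \<open>z\<close> under logits \<open>s\<close>, and \<open>z k / (1 + exp (z k * s k))\<close> is
  the centered Bernoulli variable: \<open>1 - p\<close> or \<open>- p\<close> for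
  \<open>p = 1 / (1 + exp (- s k))\<close>.\<close>

lemma centered_bernoulli_projection_tail:
  fixes s :: "nat \<Rightarrow> real" and e :: "nat \<Rightarrow> nat \<Rightarrow> real" and t :: real
  assumes "finite I"
    and orth: "\<And>i j. i < r \<Longrightarrow> j < r \<Longrightarrow> (\<Sum>k\<in>I. e i k * e j k) = of_bool (i = j)"
    and "r \<le> R"
  defines "Q \<equiv> \<lambda>z. \<Sum>i<r. (\<Sum>k\<in>I. e i k * (z k / (1 + exp (z k * s k))))\<^sup>2"
  shows "(\<Sum>z | z \<in> I \<rightarrow>\<^sub>E {-1, 1} \<and> real R + 2 * t < Q z. \<Prod>k\<in>I. 1 / (1 + exp (- z k * s k)))
    \<le> exp (- 2 * t)"
proof -
  define Z where "Z = I \<rightarrow>\<^sub>E {-1, 1 :: real}"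
  define q where "q z = (\<Prod>k\<in>I. 1 / (1 + exp (- z k * s k)))" for z
  define V where "V z k = z k / (1 + exp (z k * s k))" for z k
  have nz: "1 + exp y > 0" for y :: real
    using exp_gt_zero[of y] by linarith
  have "finite Z"
    unfolding Z_def using \<open>finite I\<close> by (intro finite_PiE) auto
  have q_nonneg: "0 \<le> q z" for z
    unfolding q_def using nz by (intro prod_nonneg) (simp add: less_imp_le)
  have subgaussian: "(\<Sum>z\<in>Z. q z * exp (\<Sum>k\<in>I. w k * V z k)) \<le> exp ((\<Sum>k\<in>I. (w k)\<^sup>2) / 8)" for w
  proof -
    have "(\<Sum>z\<in>Z. q z * exp (\<Sum>k\<in>I. w k * V z k))
        = (\<Sum>z\<in>Z. \<Prod>k\<in>I. 1 / (1 + exp (- z k * s k)) * exp (w k * (z k / (1 + exp (z k * s k)))))"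
      by (simp only: q_def V_def exp_sum[OF \<open>finite I\<close>] prod.distrib)
    \<comment> \<open>Independence: summing a product over all sign patterns gives a product of
      two-term sums.\<close>
    also have "\<dots> = (\<Prod>k\<in>I. \<Sum>y\<in>{-1, 1}. 1 / (1 + exp (- y * s k)) * exp (w k * (y / (1 + exp (y * s k)))))"
      unfolding Z_def by (rule prod_sum_PiE[symmetric]) (use \<open>finite I\<close> in auto)
    also have "\<dots> \<le> (\<Prod>k\<in>I. exp ((w k)\<^sup>2 / 8))"
    proof (rule prod_mono)
      fix k
      define p where "p = 1 / (1 + exp (- s k))"
      have p: "0 \<le> p" "p \<le> 1" "1 / (1 + exp (s k)) = 1 - p"
        using nz[of "s k"] nz[of "- s k"] by (auto simp: p_def exp_minus field_simps)
      have "(\<Sum>y\<in>{-1, 1}. 1 / (1 + exp (- y * s k)) * exp (w k * (y / (1 + exp (y * s k)))))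
          = 1 / (1 + exp (s k)) * exp (w k * - (1 / (1 + exp (- s k))))
            + 1 / (1 + exp (- s k)) * exp (w k * (1 / (1 + exp (s k))))"
        by simp
      also have "\<dots> = p * exp (w k * (1 - p)) + (1 - p) * exp (- (w k * p))"
        unfolding p(3) p_def[symmetric] by simp
      finally have "(\<Sum>y\<in>{-1, 1}. 1 / (1 + exp (- y * s k)) * exp (w k * (y / (1 + exp (y * s k))))) = \<dots>" .
      moreover have "0 \<le> p * exp (w k * (1 - p)) + (1 - p) * exp (- (w k * p))"
        using p by simp
      ultimately show "0 \<le> (\<Sum>y\<in>{-1, 1}. 1 / (1 + exp (- y * s k)) * exp (w k * (y / (1 + exp (y * s k))))) \<and>
          (\<Sum>y\<in>{-1, 1}. 1 / (1 + exp (- y * s k)) * exp (w k * (y / (1 + exp (y * s k))))) \<le> exp ((w k)\<^sup>2 / 8)"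
        using bernoulli_exp_moment_le[OF p(1,2), of "w k"] by linarith
    qed
    also have "\<dots> = exp ((\<Sum>k\<in>I. (w k)\<^sup>2) / 8)"
      by (simp add: exp_sum[OF \<open>finite I\<close>, symmetric] sum_divide_distrib)
    finally show ?thesis .
  qed
  have "(\<Sum>z\<in>Z. q z * exp (Q z)) \<le> sqrt 2 ^ r"
    using exp_moment_projection_le[of Z q V I r e "\<lambda>_. 0"] q_nonneg subgaussian orth
    by (simp add: Q_def V_def)
  \<comment> \<open>The crude \<open>sqrt 2 \<le> exp 1\<close> bounds the moment by
    \<open>exp R\<close>, which cancels against the \<open>R\<close> in the threshold.\<close>
  also have "\<dots> \<le> exp 1 ^ r"
  proof (rule power_mono)
    have "sqrt 2 \<le> sqrt (2\<^sup>2)"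
      by (intro real_sqrt_le_mono) simp
    also have "\<dots> \<le> exp 1"
      using exp_ge_add_one_self[of "1 :: real"] by simp
    finally show "sqrt 2 \<le> exp 1" .
  qed simp
  also have "\<dots> \<le> exp (real R)"
    using \<open>r \<le> R\<close> by (simp add: exp_of_nat_mult[symmetric])
  finally have moment: "(\<Sum>z\<in>Z. q z * exp (Q z)) \<le> exp (real R)" .
  \<comment> \<open>Markov's inequality for \<open>exp (Q z)\<close>, multiplied out.\<close>
  have "exp (real R + 2 * t) * (\<Sum>z | z \<in> Z \<and> real R + 2 * t < Q z. q z)
      = (\<Sum>z | z \<in> Z \<and> real R + 2 * t < Q z. q z * exp (real R + 2 * t))"
    by (simp add: sum_distrib_left mult.commute)
  also have "\<dots> \<le> (\<Sum>z | z \<in> Z \<and> real R + 2 * t < Q z. q z * exp (Q z))"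
    using q_nonneg by (intro sum_mono mult_left_mono) auto
  also have "\<dots> \<le> (\<Sum>z\<in>Z. q z * exp (Q z))"
    using \<open>finite Z\<close> q_nonneg by (intro sum_mono2) auto
  also note moment
  finally have "(\<Sum>z | z \<in> Z \<and> real R + 2 * t < Q z. q z) \<le> exp (real R) / exp (real R + 2 * t)"
    by (simp add: pos_le_divide_eq mult.commute)
  also have "\<dots> = exp (- 2 * t)"
    by (simp add: exp_diff[symmetric])
  finally show ?thesis
    unfolding Z_def q_def .
qed

subsection \<open>Rank and minimum eigenvalue\<close>

text \<open>A maximal independent set of columns has rank many elements and spans all the
  others.\<close>

lemma columns_in_span_of_rank_many:
  fixes A :: "real mat"
  assumes A: "A \<in> carrier_mat n m"
  obtains J where "J \<subseteq> {..<m}" "card J \<le> vec_space.rank n A"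
    "\<And>j. j < m \<Longrightarrow> \<exists>c. \<forall>i<n. A $$ (i, j) = (\<Sum>l\<in>J. c l * A $$ (i, l))"
proof -
  interpret vec_space "TYPE(real)" n .
  have carrier: "set (cols A) \<subseteq> carrier_vec n"
    using cols_dim A by blast
  obtain S where S: "finite S" "maximal S (\<lambda>T. T \<subseteq> set (cols A) \<and> lin_indpt T)"
  proof -
    have "lin_indpt {}"
      by (simp add: lin_dep_def)
    then show ?thesis
      using maximal_exists_superset[of "set (cols A)" "\<lambda>T. T \<subseteq> set (cols A) \<and> lin_indpt T" "{}"] that
      by blast
  qed
  then have S_cols: "S \<subseteq> set (cols A)" and indep: "lin_indpt S"
    by (auto simp: maximal_def)
  have S_carrier: "S \<subseteq> carrier_vec n"
    using S_cols carrier by blast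
  have rank: "rank A = card S"
    by (rule rank_card_indpt[OF A S(2)])
  have in_span: "v \<in> span S" if v: "v \<in> set (cols A)" for v
  proof (rule ccontr)
    assume not_in: "v \<notin> span S"
    then have "v \<notin> S"
      using span_mem[OF S_carrier] by auto
    moreover have "lin_indpt (insert v S)"
      using lin_dep_iff_in_span[of S v] S_carrier indep v carrier \<open>v \<notin> S\<close> not_in by auto
    ultimately show False
      using S(2) S_cols v unfolding maximal_def by blast
  qed
  \<comment> \<open>Vectors are traded for indices: equal columns count once in \<open>S\<close>,
    and \<open>f\<close> picks one index for each.\<close>
  have "\<forall>s\<in>S. \<exists>l<m. col A l = s"
    using S_cols A by (force simp: cols_def)
  then obtain f where f: "\<And>s. s \<in> S \<Longrightarrow> f s < m \<and> col A (f s) = s"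
    by metis
  have inj: "inj_on f S"
    using f by (metis inj_onI)
  show ?thesis
  proof
    show "f ` S \<subseteq> {..<m}"
      using f by auto
    show "card (f ` S) \<le> rank A"
      using rank S(1) card_image_le by metis
    fix j assume j: "j < m"
    then have "col A j \<in> set (cols A)"
      using A by (auto simp: cols_def)
    then obtain a where a: "lincomb a S = col A j"
      using finite_in_span[OF S(1) S_carrier in_span] by metis
    have "A $$ (i, j) = (\<Sum>l\<in>f ` S. a (col A l) * A $$ (i, l))" if i: "i < n" for i
    proof -
      have "A $$ (i, j) = col A j $ i"
        using A i j by simp
      also have "\<dots> = (\<Sum>s\<in>S. a s * s $ i)"
        unfolding a[symmetric] using i S_carrier by (rule lincomb_index)
      also have "\<dots> = (\<Sum>s\<in>S. a (col A (f s)) * A $$ (i, f s))"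
      proof (rule sum.cong)
        fix s assume "s \<in> S"
        then have "f s < m" "col A (f s) = s"
          using f by auto
        moreover have "col A (f s) $ i = A $$ (i, f s)"
          using A i \<open>f s < m\<close> by simp
        ultimately show "a s * s $ i = a (col A (f s)) * A $$ (i, f s)"
          by simp
      qed simp
      also have "\<dots> = (\<Sum>l\<in>f ` S. a (col A l) * A $$ (i, l))"
        by (simp add: sum.reindex[OF inj])
      finally show ?thesis .
    qed
    then show "\<exists>c. \<forall>i<n. A $$ (i, j) = (\<Sum>l\<in>f ` S. c l * A $$ (i, l))"
      by (intro exI[of _ "\<lambda>l. a (col A l)"]) simp
  qed
qed

lemma Sigma_D_carrier: "Sigma_D K N p \<in> carrier_mat (N - 1) (N - 1)"
  by (rule carrier_matI) (simp_all add: Sigma_D_def design_matrix_def)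

lemma Sigma_D_index:
  assumes "i < N - 1" "j < N - 1"
  shows "Sigma_D K N p $$ (i, j) = (\<Sum>k=1..K. p k (i + 2) * p k (j + 2)) / real K"
  using assms
  by (simp add: Sigma_D_def design_matrix_def scalar_prod_def sum.atLeast1_atMost_eq lessThan_atLeast0)

text \<open>A relation between columns of the Gram matrix \<open>P\<^sup>T P\<close> is one between columns of \<open>P\<close>,
  since \<open>P\<^sup>T d = 0\<close> for \<open>d\<close> in the column space of \<open>P\<close> forces \<open>d = 0\<close>.\<close>

lemma design_columns_in_span_of_rank_many:
  assumes "1 \<le> K"
  obtains J where "J \<subseteq> {2..N}" "card J \<le> vec_space.rank (N - 1) (Sigma_D K N p)"
    "\<And>j. j \<in> {2..N} \<Longrightarrow> \<exists>c. \<forall>k\<in>{1..K}. p k j = (\<Sum>l\<in>J. c l * p k l)"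
proof -
  obtain J where J: "J \<subseteq> {..<N - 1}" "card J \<le> vec_space.rank (N - 1) (Sigma_D K N p)"
    and span: "\<And>j. j < N - 1 \<Longrightarrow>
      \<exists>c. \<forall>i<N - 1. Sigma_D K N p $$ (i, j) = (\<Sum>l\<in>J. c l * Sigma_D K N p $$ (i, l))"
    by (rule columns_in_span_of_rank_many[OF Sigma_D_carrier[of K N p]]) (rule that)
  have fin: "finite J"
    using J(1) finite_subset by blast
  show ?thesis
  proof
    show "(\<lambda>l. l + 2) ` J \<subseteq> {2..N}"
      using J(1) by fastforce
    show "card ((\<lambda>l. l + 2) ` J) \<le> vec_space.rank (N - 1) (Sigma_D K N p)"
      using J(2) card_image_le[OF fin] order_trans by blast
    fix j assume j: "j \<in> {2..N}"
    define j' where "j' = j - 2"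
    have j': "j' < N - 1" "j' + 2 = j"
      using j by (auto simp: j'_def)
    obtain c where c: "\<And>i. i < N - 1 \<Longrightarrow>
        Sigma_D K N p $$ (i, j') = (\<Sum>l\<in>J. c l * Sigma_D K N p $$ (i, l))"
      using span[OF j'(1)] by blast
    \<comment> \<open>Defect of the Gram relation when read on columns of the design matrix. The
      shift by 2 goes from matrix columns to breakpoints.\<close>
    define d where "d k = p k j - (\<Sum>l\<in>J. c l * p k (l + 2))" for k
    have orth: "(\<Sum>k=1..K. p k (i + 2) * d k) = 0" if "i < N - 1" for i
    proof -
      have "(\<Sum>k=1..K. p k (i + 2) * p k j) / real K
          = (\<Sum>l\<in>J. c l * ((\<Sum>k=1..K. p k (i + 2) * p k (l + 2)) / real K))"
        using c[OF that] J(1) that j' by (simp add: Sigma_D_index subset_eq)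
      also have "\<dots> = (\<Sum>l\<in>J. c l * (\<Sum>k=1..K. p k (l + 2) * p k (i + 2))) / real K"
        by (simp add: sum_divide_distrib[symmetric] mult_ac)
      also have "(\<Sum>l\<in>J. c l * (\<Sum>k=1..K. p k (l + 2) * p k (i + 2)))
          = (\<Sum>k=1..K. p k (i + 2) * (\<Sum>l\<in>J. c l * p k (l + 2)))"
        unfolding sum_distrib_left by (subst sum.swap) (simp add: mult_ac)
      finally show ?thesis
        using assms by (simp add: d_def right_diff_distrib sum_subtractf)
    qed
    have "(\<Sum>k=1..K. d k * d k)
        = (\<Sum>k=1..K. p k j * d k) - (\<Sum>k=1..K. d k * (\<Sum>l\<in>J. c l * p k (l + 2)))"
      unfolding sum_subtractf[symmetric] by (intro sum.cong) (simp_all add: d_def algebra_simps)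
    also have "(\<Sum>k=1..K. d k * (\<Sum>l\<in>J. c l * p k (l + 2)))
        = (\<Sum>l\<in>J. c l * (\<Sum>k=1..K. p k (l + 2) * d k))"
      unfolding sum_distrib_left by (subst sum.swap) (simp add: mult_ac)
    also have "\<dots> = 0"
      using orth J(1) by (intro sum.neutral) auto
    also have "(\<Sum>k=1..K. p k j * d k) = 0"
      using orth[OF j'(1)] j'(2) by simp
    finally have "\<forall>k\<in>{1..K}. d k = 0"
      by (simp add: sum_nonneg_eq_0_iff)
    then have "\<forall>k\<in>{1..K}. p k j = (\<Sum>l\<in>(\<lambda>l. l + 2) ` J. c (l - 2) * p k l)"
      by (simp add: d_def sum.reindex inj_on_def)
    then show "\<exists>c. \<forall>k\<in>{1..K}. p k j = (\<Sum>l\<in>(\<lambda>l. l + 2) ` J. c l * p k l)"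
      by (intro exI[of _ "\<lambda>l. c (l - 2)"])
  qed
qed

section \<open>Smallest eigenvalue as the minimum of the Rayleigh quotient\<close>

lemma linear_coeff_zero_if_nonneg:
  fixes a b :: real
  assumes "\<And>t. 0 \<le> t * a + t\<^sup>2 * b"
  shows "a = 0"
proof -
  have "0 \<le> b"
    using assms[of 1] assms[of "-1"] by simp
  \<comment> \<open>The denominator \<open>b + 1\<close> is positive even for \<open>b = 0\<close>,
    and with it the quadratic takes exactly the value \<open>- t\<^sup>2\<close>.\<close>
  define t where "t = - a / (b + 1)"
  have "a = - t * (b + 1)"
    using \<open>0 \<le> b\<close> by (simp add: t_def field_simps)
  then have "t * a + t\<^sup>2 * b = - t\<^sup>2"
    by (simp only:) (simp add: power2_eq_square algebra_simps)
  then have "t = 0"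
    using assms[of t] by simp
  then show ?thesis
    using \<open>a = - t * (b + 1)\<close> by simp
qed

text \<open>Vectors of length \<open>n\<close> are functions vanishing from \<open>n\<close> on, so
  the sphere is a closed part of a product of compact sets, compact by Tychonoff's theorem.\<close>

lemma compact_unit_sphere_fun:
  "compact {v :: nat \<Rightarrow> real. (\<forall>i\<ge>n. v i = 0) \<and> (\<Sum>i<n. (v i)\<^sup>2) = 1}"
proof -
  define B where "B i = (if i < n then {-1..1 :: real} else {0})" for i
  have "compactin (product_topology (\<lambda>_. euclidean) UNIV) (PiE UNIV B)"
    by (simp add: compactin_PiE B_def)
  then have "compact (PiE UNIV B)"
    by (simp add: euclidean_product_topology)
  moreover have "closed {v :: nat \<Rightarrow> real. (\<Sum>i<n. (v i)\<^sup>2) = 1}"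
    by (intro closed_Collect_eq continuous_intros continuous_on_product_coordinates)
  ultimately have "compact (PiE UNIV B \<inter> {v. (\<Sum>i<n. (v i)\<^sup>2) = 1})"
    by (rule compact_Int_closed)
  moreover have "PiE UNIV B \<inter> {v. (\<Sum>i<n. (v i)\<^sup>2) = 1}
      = {v. (\<forall>i\<ge>n. v i = 0) \<and> (\<Sum>i<n. (v i)\<^sup>2) = 1}"
  proof (intro equalityI subsetI)
    fix v :: "nat \<Rightarrow> real"
    assume v: "v \<in> {v. (\<forall>i\<ge>n. v i = 0) \<and> (\<Sum>i<n. (v i)\<^sup>2) = 1}"
    have "v i \<in> B i" for i
    proof (cases "i < n")
      case True
      then have "(v i)\<^sup>2 \<le> (\<Sum>i<n. (v i)\<^sup>2)"
        by (intro member_le_sum) auto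
      then have "\<bar>v i\<bar> \<le> 1"
        using v by (simp add: abs_square_le_1)
      then show ?thesis
        using True by (simp add: B_def abs_le_iff)
    qed (use v in \<open>simp add: B_def\<close>)
    then show "v \<in> PiE UNIV B \<inter> {v. (\<Sum>i<n. (v i)\<^sup>2) = 1}"
      using v by (simp add: PiE_UNIV_domain)
  next
    fix v assume v: "v \<in> PiE UNIV B \<inter> {v. (\<Sum>i<n. (v i)\<^sup>2) = 1}"
    then have "v i \<in> B i" for i
      by (simp add: PiE_UNIV_domain Pi_iff)
    then have "v i = 0" if "n \<le> i" for i
      using that by (metis B_def leD singletonD)
    then show "v \<in> {v. (\<forall>i\<ge>n. v i = 0) \<and> (\<Sum>i<n. (v i)\<^sup>2) = 1}"
      using v by simp
  qed
  ultimately show ?thesis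
    by simp
qed

text \<open>The quadratic form attains its minimum \<open>m\<close> on the unit sphere, and a
  minimiser is an eigenvector because the first variation vanishes.\<close>

lemma symmetric_min_eigenvector:
  fixes a :: "nat \<Rightarrow> nat \<Rightarrow> real"
  assumes "0 < n" and sym: "\<And>i j. i < n \<Longrightarrow> j < n \<Longrightarrow> a i j = a j i"
  obtains m v where "(\<Sum>i<n. (v i)\<^sup>2) = 1" "\<And>i. i < n \<Longrightarrow> (\<Sum>j<n. a i j * v j) = m * v i"
    "\<And>w. m * (\<Sum>i<n. (w i)\<^sup>2) \<le> (\<Sum>i<n. \<Sum>j<n. w i * a i j * w j)"
proof -
  define q where "q w = (\<Sum>i<n. \<Sum>j<n. w i * a i j * w j)" for w :: "nat \<Rightarrow> real"
  define C where "C = {v :: nat \<Rightarrow> real. (\<forall>i\<ge>n. v i = 0) \<and> (\<Sum>i<n. (v i)\<^sup>2) = 1}"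
  have "(\<lambda>i. if i = 0 then 1 else 0) \<in> C"
    using assms(1) by (simp add: C_def if_distrib[of "\<lambda>x. x\<^sup>2"] cong: if_cong)
  then have "C \<noteq> {}"
    by blast
  moreover have "compact C"
    unfolding C_def by (rule compact_unit_sphere_fun)
  moreover have "continuous_on C q"
    unfolding q_def
    by (intro continuous_intros continuous_on_subset[OF continuous_on_product_coordinates]) auto
  ultimately obtain v where v: "v \<in> C" and min: "\<And>w. w \<in> C \<Longrightarrow> q v \<le> q w"
    using continuous_attains_inf[of C q] by blast
  have unit: "(\<Sum>i<n. (v i)\<^sup>2) = 1"
    using v by (simp add: C_def)
  \<comment> \<open>Homogeneity of degree 2 carries the minimum from the sphere to all
    vectors.\<close>
  have le: "q v * (\<Sum>i<n. (w i)\<^sup>2) \<le> q w" for w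
  proof (cases "(\<Sum>i<n. (w i)\<^sup>2) = 0")
    case True
    then have "\<forall>i<n. w i = 0"
      by (simp add: sum_nonneg_eq_0_iff)
    then show ?thesis
      unfolding True by (simp add: q_def)
  next
    case False
    define s where "s = sqrt (\<Sum>i<n. (w i)\<^sup>2)"
    have s2: "s\<^sup>2 = (\<Sum>i<n. (w i)\<^sup>2)"
      by (simp add: s_def sum_nonneg)
    have "s \<noteq> 0"
      using False s2 by auto
    define w' where "w' i = (if i < n then w i / s else 0)" for i
    have "(\<Sum>i<n. (w' i)\<^sup>2) = 1"
      using False by (simp add: w'_def power_divide sum_divide_distrib[symmetric] s2)
    then have "w' \<in> C"
      by (simp add: C_def w'_def)
    then have "q v \<le> q w'"
      by (rule min)
    also have "q w' = q w / s\<^sup>2"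
      by (simp add: q_def w'_def sum_divide_distrib power2_eq_square)
    finally have "q v * s\<^sup>2 \<le> q w / s\<^sup>2 * s\<^sup>2"
      by (rule mult_right_mono) simp
    also have "q w / s\<^sup>2 * s\<^sup>2 = q w"
      using \<open>s \<noteq> 0\<close> by simp
    finally have "q v * s\<^sup>2 \<le> q w" .
    then show ?thesis
      by (simp add: s2)
  qed
  have eigen: "(\<Sum>j<n. a i j * v j) = q v * v i" if "i < n" for i
  proof -
    \<comment> \<open>Perturbation of the minimiser in coordinate \<open>i\<close>. The term linear
      in \<open>t\<close> of the inequality \<open>le\<close> at \<open>x t\<close> yields entry
      \<open>i\<close> of the eigenvalue equation.\<close>
    define x where "x t j = v j + (if j = i then t else 0)" for t j
    have col: "(\<Sum>k<n. v k * a k i) = (\<Sum>j<n. a i j * v j)"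
      using sym that by (intro sum.cong) auto
    have inner: "(\<Sum>l<n. a k l * x t l) = (\<Sum>l<n. a k l * v l) + t * a k i" for k t
      using that by (simp add: x_def distrib_left sum.distrib if_distrib[of "(*) _"] cong: if_cong)
    have ins: "(\<Sum>k<n. x t k * g k) = (\<Sum>k<n. v k * g k) + t * g i" for g t
      using that
      by (simp add: x_def distrib_right sum.distrib if_distrib[of "\<lambda>x. x * _"] cong: if_cong)
    have "q (x t) = (\<Sum>k<n. x t k * (\<Sum>l<n. a k l * x t l))" for t
      by (simp add: q_def sum_distrib_left mult.assoc)
    also have "\<dots> t = (\<Sum>k<n. v k * (\<Sum>l<n. a k l * v l)) + t * (\<Sum>k<n. v k * a k i)
        + (t * (\<Sum>l<n. a i l * v l) + t * (t * a i i))" for t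
      unfolding ins inner by (simp add: distrib_left sum.distrib sum_distrib_left mult_ac)
    finally have q_x: "q (x t) = q v + 2 * t * (\<Sum>j<n. a i j * v j) + t\<^sup>2 * a i i" for t
      unfolding col by (simp add: q_def sum_distrib_left mult.assoc power2_eq_square)
    have n_x: "(\<Sum>k<n. (x t k)\<^sup>2) = 1 + 2 * t * v i + t\<^sup>2" for t
    proof -
      have "(\<Sum>k<n. (x t k)\<^sup>2) = (\<Sum>k<n. (v k)\<^sup>2 + (if k = i then 2 * t * v k + t\<^sup>2 else 0))"
        by (intro sum.cong) (auto simp: x_def power2_sum)
      then show ?thesis
        using that unit by (simp add: sum.distrib)
    qed
    have "0 \<le> t * (2 * ((\<Sum>j<n. a i j * v j) - q v * v i)) + t\<^sup>2 * (a i i - q v)" for t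
      using le[of "x t"] unfolding q_x n_x by (simp add: algebra_simps)
    from linear_coeff_zero_if_nonneg[OF this] show ?thesis
      by simp
  qed
  from unit eigen le show ?thesis
    unfolding q_def by (rule that)
qed

text \<open>The Rayleigh minimum is an eigenvalue, so the spectrum is nonempty and its
  \<open>Min\<close> is at most that value. Testing \<open>lower\<close> on an eigenvector of this
  \<open>Min\<close> bounds it from below.\<close>

lemma min_eigenvalue_quadratic_form:
  fixes A :: "real mat"
  assumes A: "A \<in> carrier_mat n n" and "0 < n"
    and sym: "\<And>i j. i < n \<Longrightarrow> j < n \<Longrightarrow> A $$ (i, j) = A $$ (j, i)"
    and lower: "\<And>w. m0 * (\<Sum>i<n. (w i)\<^sup>2) \<le> (\<Sum>i<n. \<Sum>j<n. w i * A $$ (i, j) * w j)"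
  shows "m0 \<le> min_eigenvalue A"
    and "min_eigenvalue A * (\<Sum>i<n. (w i)\<^sup>2) \<le> (\<Sum>i<n. \<Sum>j<n. w i * A $$ (i, j) * w j)"
proof -
  obtain m v where v: "(\<Sum>i<n. (v i)\<^sup>2) = 1"
    "\<And>i. i < n \<Longrightarrow> (\<Sum>j<n. A $$ (i, j) * v j) = m * v i"
    and rayleigh: "\<And>w. m * (\<Sum>i<n. (w i)\<^sup>2) \<le> (\<Sum>i<n. \<Sum>j<n. w i * A $$ (i, j) * w j)"
    by (rule symmetric_min_eigenvector[of n "\<lambda>i j. A $$ (i, j)", OF \<open>0 < n\<close>])
      (rule sym that; assumption)+
  have "Matrix.vec n v \<noteq> 0\<^sub>v n"
  proof
    assume *: "Matrix.vec n v = 0\<^sub>v n"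
    have "v i = 0" if "i < n" for i
      using arg_cong[OF *, of "\<lambda>x. x $ i"] that by simp
    then show False
      using v(1) by simp
  qed
  moreover have "A *\<^sub>v Matrix.vec n v = m \<cdot>\<^sub>v Matrix.vec n v"
    using A v(2) by (intro eq_vecI) (auto simp: scalar_prod_def lessThan_atLeast0)
  ultimately have m: "m \<in> spectrum A"
    using A by (auto simp: spectrum_def eigenvalue_def eigenvector_def intro!: exI[of _ "Matrix.vec n v"])
  have fin: "finite (spectrum A)"
    using A by (rule card_finite_spectrum)
  have "min_eigenvalue A \<le> m"
    using fin m by (simp add: min_eigenvalue_def)
  then have "min_eigenvalue A * (\<Sum>i<n. (w i)\<^sup>2) \<le> m * (\<Sum>i<n. (w i)\<^sup>2)"
    by (intro mult_right_mono sum_nonneg) auto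
  then show "min_eigenvalue A * (\<Sum>i<n. (w i)\<^sup>2) \<le> (\<Sum>i<n. \<Sum>j<n. w i * A $$ (i, j) * w j)"
    using rayleigh[of w] by linarith
  have "min_eigenvalue A \<in> spectrum A"
    unfolding min_eigenvalue_def using fin m by (intro Min_in) auto
  then obtain x where x: "x \<in> carrier_vec n" "x \<noteq> 0\<^sub>v n"
    "A *\<^sub>v x = min_eigenvalue A \<cdot>\<^sub>v x"
    using A by (auto simp: spectrum_def eigenvalue_def eigenvector_def)
  have entry: "(\<Sum>j<n. A $$ (i, j) * x $ j) = min_eigenvalue A * x $ i" if "i < n" for i
    using arg_cong[OF x(3), of "\<lambda>y. y $ i"] that A x(1)
    by (simp add: scalar_prod_def lessThan_atLeast0)
  have "(\<Sum>i<n. \<Sum>j<n. x $ i * A $$ (i, j) * x $ j)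
      = (\<Sum>i<n. x $ i * (\<Sum>j<n. A $$ (i, j) * x $ j))"
    by (simp add: sum_distrib_left mult.assoc)
  also have "\<dots> = (\<Sum>i<n. x $ i * (min_eigenvalue A * x $ i))"
    using entry by (intro sum.cong) auto
  also have "\<dots> = min_eigenvalue A * (\<Sum>i<n. (x $ i)\<^sup>2)"
    by (simp add: sum_distrib_left power2_eq_square mult_ac)
  finally have "m0 * (\<Sum>i<n. (x $ i)\<^sup>2) \<le> min_eigenvalue A * (\<Sum>i<n. (x $ i)\<^sup>2)"
    using lower[of "\<lambda>i. x $ i"] by simp
  moreover have "0 < (\<Sum>i<n. (x $ i)\<^sup>2)"
  proof -
    obtain i where "i < n" "x $ i \<noteq> 0"
      using x(1,2) by (metis carrier_vecD eq_vecI index_zero_vec)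
    then show ?thesis
      by (intro sum_pos2[of _ i]) auto
  qed
  ultimately show "m0 \<le> min_eigenvalue A"
    by simp
qed

lemma regularized_Sigma_D_quadratic_form:
  assumes "1 \<le> K"
  shows "(\<Sum>i<N - 1. \<Sum>j<N - 1. v i * (Sigma_D K N p + lam \<cdot>\<^sub>m 1\<^sub>m (N - 1)) $$ (i, j) * v j)
    = (\<Sum>k=1..K. (\<Sum>i<N - 1. v i * p k (i + 2))\<^sup>2) / real K + lam * (\<Sum>i<N - 1. (v i)\<^sup>2)"
proof -
  have entry: "(Sigma_D K N p + lam \<cdot>\<^sub>m 1\<^sub>m (N - 1)) $$ (i, j)
      = (\<Sum>k=1..K. p k (i + 2) * p k (j + 2)) / real K + (if i = j then lam else 0)"
    if "i < N - 1" "j < N - 1" for i j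
    using that Sigma_D_index[OF that] Sigma_D_carrier[of K N p] by simp
  have "(\<Sum>i<N - 1. \<Sum>j<N - 1. v i * (Sigma_D K N p + lam \<cdot>\<^sub>m 1\<^sub>m (N - 1)) $$ (i, j) * v j)
      = (\<Sum>i<N - 1. \<Sum>j<N - 1. (\<Sum>k=1..K. (v i * p k (i + 2)) * (v j * p k (j + 2))) / real K
          + (if i = j then lam * v i * v j else 0))"
  proof (intro sum.cong refl)
    fix i j assume ij: "i \<in> {..<N - 1}" "j \<in> {..<N - 1}"
    have "v i * ((\<Sum>k=1..K. p k (i + 2) * p k (j + 2)) / real K) * v j
        = (\<Sum>k=1..K. (v i * p k (i + 2)) * (v j * p k (j + 2))) / real K"
      by (simp add: sum_distrib_left sum_distrib_right mult_ac)
    moreover have "v i * (g + (if i = j then lam else 0)) * v j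
        = v i * g * v j + (if i = j then lam * v i * v j else 0)" for g
      by (simp add: algebra_simps)
    ultimately show "v i * (Sigma_D K N p + lam \<cdot>\<^sub>m 1\<^sub>m (N - 1)) $$ (i, j) * v j
        = (\<Sum>k=1..K. (v i * p k (i + 2)) * (v j * p k (j + 2))) / real K + (if i = j then lam * v i * v j else 0)"
      unfolding entry[OF ij[unfolded lessThan_iff]] by (simp only:)
  qed
  also have "\<dots> = (\<Sum>i<N - 1. \<Sum>j<N - 1. \<Sum>k=1..K. (v i * p k (i + 2)) * (v j * p k (j + 2))) / real K
      + lam * (\<Sum>i<N - 1. (v i)\<^sup>2)"
    by (simp add: sum.distrib sum_divide_distrib sum_distrib_left power2_eq_square mult.assoc)
  also have "(\<Sum>i<N - 1. \<Sum>j<N - 1. \<Sum>k=1..K. (v i * p k (i + 2)) * (v j * p k (j + 2)))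
      = (\<Sum>i<N - 1. \<Sum>k=1..K. \<Sum>j<N - 1. (v i * p k (i + 2)) * (v j * p k (j + 2)))"
    by (intro sum.cong refl sum.swap)
  also have "\<dots> = (\<Sum>k=1..K. \<Sum>i<N - 1. \<Sum>j<N - 1. (v i * p k (i + 2)) * (v j * p k (j + 2)))"
    by (rule sum.swap)
  also have "\<dots> = (\<Sum>k=1..K. (\<Sum>i<N - 1. v i * p k (i + 2))\<^sup>2)"
    by (simp only: power2_eq_square sum_product)
  finally show ?thesis .
qed

text \<open>\<open>Sigma_D\<close> is positive semidefinite, so the shift keeps the eigenvalues
  above \<open>lam\<close>. For positive \<open>lam\<close> the denominator of the error bound is
  thus positive.\<close>

lemma min_eigenvalue_regularized_Sigma_D:
  assumes "1 \<le> K" "2 \<le> N"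
  shows "lam \<le> min_eigenvalue (Sigma_D K N p + lam \<cdot>\<^sub>m 1\<^sub>m (N - 1))"
    and "min_eigenvalue (Sigma_D K N p + lam \<cdot>\<^sub>m 1\<^sub>m (N - 1)) * (\<Sum>i<N - 1. (v i)\<^sup>2)
      \<le> (\<Sum>k=1..K. (\<Sum>i<N - 1. v i * p k (i + 2))\<^sup>2) / real K + lam * (\<Sum>i<N - 1. (v i)\<^sup>2)"
proof -
  let ?A = "Sigma_D K N p + lam \<cdot>\<^sub>m 1\<^sub>m (N - 1)"
  have A: "?A \<in> carrier_mat (N - 1) (N - 1)"
    using Sigma_D_carrier[of K N p] by auto
  have sym: "?A $$ (i, j) = ?A $$ (j, i)" if "i < N - 1" "j < N - 1" for i j
    using that Sigma_D_index[OF that] Sigma_D_index[OF that(2,1)] Sigma_D_carrier[of K N p]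
    by (simp add: mult.commute)
  have lower: "lam * (\<Sum>i<N - 1. (w i)\<^sup>2) \<le> (\<Sum>i<N - 1. \<Sum>j<N - 1. w i * ?A $$ (i, j) * w j)" for w
    unfolding regularized_Sigma_D_quadratic_form[OF assms(1)] by (simp add: sum_nonneg)
  have "0 < N - 1"
    using assms(2) by simp
  note bounds = min_eigenvalue_quadratic_form[OF A this sym lower]
  show "lam \<le> min_eigenvalue ?A"
    by (rule bounds(1))
  show "min_eigenvalue ?A * (\<Sum>i<N - 1. (v i)\<^sup>2)
      \<le> (\<Sum>k=1..K. (\<Sum>i<N - 1. v i * p k (i + 2))\<^sup>2) / real K + lam * (\<Sum>i<N - 1. (v i)\<^sup>2)"
    using bounds(2)[of v] unfolding regularized_Sigma_D_quadratic_form[OF assms(1)] .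
qed

subsection \<open>Distribution of the responses\<close>

text \<open>Through this transformation the comparison of two Gumbel variables becomes one of two
  exponential variables.\<close>

lemma (in prob_space) exp_gumbel_exponential:
  assumes X[measurable]: "random_variable borel X"
    and cdf: "cdf (distr M borel X) = gumbel_cdf 0 s" and "0 < s"
  shows "distributed M lborel (\<lambda>x. exp (- X x / s)) (exponential_density 1)"
proof -
  interpret D: real_distribution "distr M borel X"
    by simp
  have "prob {x \<in> space M. exp (- X x / s) \<le> a} = 1 - exp (- a * 1)" if "0 \<le> a" for a
  proof (cases "a = 0")
    case False
    with that have "0 < a"
      by simp
    \<comment> \<open>The event \<open>exp (- X x / s) \<le> a\<close> is
      \<open>t \<le> X x\<close>, while the cdf gives the mass of \<open>{..t}\<close>. Continuity
      of the Gumbel cdf excludes an atom at \<open>t\<close>.\<close>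
    define t where "t = - s * ln a"
    have cdf_t: "measure (distr M borel X) {..t} = exp (- a)"
      using fun_cong[OF cdf, of t] \<open>0 < s\<close> \<open>0 < a\<close> by (simp add: cdf_def gumbel_cdf_def t_def)
    have "isCont (gumbel_cdf 0 s) t"
      unfolding gumbel_cdf_def using \<open>0 < s\<close> by (intro continuous_intros) auto
    then have "measure (distr M borel X) {t} = 0"
      using D.isCont_cdf unfolding cdf by simp
    moreover have "measure (distr M borel X) ({..<t} \<union> {t}) =
        measure (distr M borel X) {..<t} + measure (distr M borel X) {t}"
      by (intro D.finite_measure_Union) auto
    moreover have "{..<t} \<union> {t} = {..t}"
      by auto
    ultimately have less_t: "measure (distr M borel X) {..<t} = exp (- a)"
      using cdf_t by simp
    have "exp (- X x / s) \<le> a \<longleftrightarrow> \<not> X x < t" for x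
    proof -
      have "exp (- X x / s) \<le> a \<longleftrightarrow> - X x / s \<le> ln a"
        using \<open>0 < a\<close> by (metis exp_le_cancel_iff exp_ln)
      also have "\<dots> \<longleftrightarrow> \<not> X x < t"
        using \<open>0 < s\<close> by (auto simp: t_def field_simps)
      finally show ?thesis .
    qed
    then have "{x \<in> space M. exp (- X x / s) \<le> a} = space M - {x \<in> space M. X x < t}"
      by auto
    then have "prob {x \<in> space M. exp (- X x / s) \<le> a} = 1 - prob {x \<in> space M. X x < t}"
      by (simp add: prob_compl)
    also have "prob {x \<in> space M. X x < t} = measure (distr M borel X) {..<t}"
      by (simp add: measure_distr vimage_def Int_def conj_commute)
    finally show ?thesis
      using less_t by simp
  qed simp
  then show ?thesis
    by (subst exponential_distributed_iff) auto
qed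

text \<open>By independence the joint law is a product, and the tail of \<open>Y\<close> beyond
  \<open>a * x\<close> is integrated over the law of \<open>X\<close>.\<close>

lemma (in prob_space) prob_exponential_less:
  assumes indep: "indep_var borel X borel Y"
    and X: "distributed M lborel X (exponential_density 1)"
    and Y: "distributed M lborel Y (exponential_density 1)"
    and "0 \<le> a"
  shows "prob {x \<in> space M. a * X x < Y x} = 1 / (1 + a)"
proof -
  have [measurable]: "random_variable borel X" "random_variable borel Y"
    using indep_var_rv1[OF indep] indep_var_rv2[OF indep] by auto
  interpret DY: prob_space "distr M borel Y"
    by (rule prob_space_distr) simp
  have distr_X: "distr M borel X = density lborel (exponential_density 1)"
    using distributed_distr_eq_density[OF X] by (simp cong: distr_cong)
  have "{z \<in> space (borel \<Otimes>\<^sub>M borel). a * fst z < snd z} \<in> sets (borel \<Otimes>\<^sub>M borel :: (real \<times> real) measure)"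
    by measurable
  then have [measurable]: "{z. a * fst z < snd z} \<in> sets (borel \<Otimes>\<^sub>M borel :: (real \<times> real) measure)"
    by (simp add: space_pair_measure)
  \<comment> \<open>Up to the factor \<open>1 / (1 + a)\<close> the integrand is again an
    exponential density, of rate \<open>1 + a\<close>.\<close>
  have tail: "ennreal (exponential_density 1 x) * emeasure (distr M borel Y) {y. a * x < y}
      = ennreal (1 / (1 + a)) * ennreal (exponential_density (1 + a) x)" for x
  proof (cases "x < 0")
    case True
    then show ?thesis
      by (simp add: exponential_density_def)
  next
    case False
    have "emeasure (distr M borel Y) {y. a * x < y} = ennreal (prob {w \<in> space M. a * x < Y w})"
      by (simp add: emeasure_distr emeasure_eq_measure vimage_def Int_def conj_commute)
    also have "prob {w \<in> space M. a * x < Y w} = exp (- (a * x))"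
      using exponential_distributedD_gt[OF Y, of "a * x"] False \<open>0 \<le> a\<close> by simp
    finally have tail_Y: "emeasure (distr M borel Y) {y. a * x < y} = ennreal (exp (- (a * x)))" .
    have "exponential_density 1 x * exp (- (a * x)) = 1 / (1 + a) * exponential_density (1 + a) x"
    proof -
      have "exp (- x) * exp (- (a * x)) = exp (- x * (1 + a))"
        by (simp add: exp_add[symmetric] algebra_simps)
      moreover have "1 + a \<noteq> 0"
        using \<open>0 \<le> a\<close> by linarith
      ultimately show ?thesis
        using False by (simp add: exponential_density_def)
    qed
    then show ?thesis
      unfolding tail_Y using \<open>0 \<le> a\<close> by (subst (1 2) ennreal_mult'[symmetric]) auto
  qed
  have "emeasure M {x \<in> space M. a * X x < Y x}
      = emeasure (distr M (borel \<Otimes>\<^sub>M borel) (\<lambda>x. (X x, Y x))) {z. a * fst z < snd z}"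
    by (subst emeasure_distr) (auto intro!: arg_cong[where f = "emeasure M"])
  also have "distr M (borel \<Otimes>\<^sub>M borel) (\<lambda>x. (X x, Y x)) = distr M borel X \<Otimes>\<^sub>M distr M borel Y"
    using indep by (simp add: indep_var_distribution_eq)
  also have "emeasure (distr M borel X \<Otimes>\<^sub>M distr M borel Y) {z. a * fst z < snd z}
      = (\<integral>\<^sup>+x. emeasure (distr M borel Y) {y. a * x < y} \<partial>distr M borel X)"
    by (subst DY.emeasure_pair_measure_alt) (auto simp: vimage_def)
  also have "\<dots> = (\<integral>\<^sup>+x. ennreal (1 / (1 + a)) * ennreal (exponential_density (1 + a) x) \<partial>lborel)"
    unfolding distr_X tail[symmetric] by (rule nn_integral_density) auto
  also have "\<dots> = ennreal (1 / (1 + a)) * (\<integral>\<^sup>+x. ennreal (exponential_density (1 + a) x) \<partial>lborel)"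
    by (rule nn_integral_cmult) auto
  also have "(\<integral>\<^sup>+x. ennreal (exponential_density (1 + a) x) \<partial>lborel) = 1"
    using prob_space.emeasure_space_1[OF prob_space_exponential_density, of "1 + a"] \<open>0 \<le> a\<close>
    by (simp add: emeasure_density)
  finally show ?thesis
    using \<open>0 \<le> a\<close> by (simp add: emeasure_eq_measure)
qed

text \<open>An event about the joint pattern is a finite disjoint union of atoms \<open>E z\<close>.
  This makes the event of the error bound measurable, although it is defined through an optimisation
  problem.\<close>

lemma (in prob_space) finite_valued_indep_vars:
  fixes X :: "'i \<Rightarrow> 'a \<Rightarrow> real"
  assumes indep: "indep_vars (\<lambda>_. borel) X I" and I: "I \<noteq> {}" "finite I" and B: "finite B"
    and G: "G \<subseteq> I \<rightarrow>\<^sub>E B"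
  shows "{x \<in> space M. (\<lambda>i\<in>I. X i x) \<in> G} \<in> events"
    and "prob {x \<in> space M. (\<lambda>i\<in>I. X i x) \<in> G} = (\<Sum>z\<in>G. \<Prod>i\<in>I. prob {x \<in> space M. X i x = z i})"
proof -
  define E where "E z = (\<Inter>i\<in>I. X i -` {z i} \<inter> space M)" for z
  have rv: "random_variable borel (X i)" if "i \<in> I" for i
    using indep that by (simp add: indep_vars_def)
  have "finite G"
    by (rule finite_subset[OF G]) (use I(2) B in \<open>simp add: finite_PiE\<close>)
  have E: "E z \<in> events" for z
    unfolding E_def using I by (intro sets.finite_INT measurable_sets[OF rv]) auto
  have eq: "{x \<in> space M. (\<lambda>i\<in>I. X i x) \<in> G} = (\<Union>z\<in>G. E z)"
  proof (intro equalityI subsetI)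
    fix x assume "x \<in> {x \<in> space M. (\<lambda>i\<in>I. X i x) \<in> G}"
    then show "x \<in> (\<Union>z\<in>G. E z)"
      by (intro UN_I[of "\<lambda>i\<in>I. X i x"]) (auto simp: E_def)
  next
    fix x assume "x \<in> (\<Union>z\<in>G. E z)"
    then obtain z where z: "z \<in> G" "x \<in> E z"
      by blast
    then have "(\<lambda>i\<in>I. X i x) = z"
    proof -
      have "X i x = z i" if "i \<in> I" for i
        using z(2) that unfolding E_def by blast
      then have "(\<lambda>i\<in>I. X i x) = restrict z I"
        by (rule restrict_ext)
      also have "\<dots> = z"
        using z(1) G by (intro PiE_restrict) auto
      finally show ?thesis .
    qed
    then show "x \<in> {x \<in> space M. (\<lambda>i\<in>I. X i x) \<in> G}"
      using z I by (auto simp: E_def)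
  qed
  show "{x \<in> space M. (\<lambda>i\<in>I. X i x) \<in> G} \<in> events"
    unfolding eq using \<open>finite G\<close> E by auto
  have "disjoint_family_on E G"
  proof (unfold disjoint_family_on_def, intro ballI impI)
    fix z z' assume zs: "z \<in> G" "z' \<in> G" "z \<noteq> z'"
    then obtain i where "i \<in> I" "z i \<noteq> z' i"
      using G by (meson PiE_ext subsetD)
    then show "E z \<inter> E z' = {}"
      by (auto simp: E_def)
  qed
  then have "prob (\<Union>z\<in>G. E z) = (\<Sum>z\<in>G. prob (E z))"
    using \<open>finite G\<close> E by (intro finite_measure_finite_Union) auto
  also have "\<dots> = (\<Sum>z\<in>G. \<Prod>i\<in>I. prob (X i -` {z i} \<inter> space M))"
    unfolding E_def using indep I by (intro sum.cong refl indep_varsD_finite) auto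
  finally show "prob {x \<in> space M. (\<lambda>i\<in>I. X i x) \<in> G}
      = (\<Sum>z\<in>G. \<Prod>i\<in>I. prob {x \<in> space M. X i x = z i})"
    unfolding eq by (simp add: vimage_def Int_def conj_commute)
qed

text \<open>The noise is grouped into the disjoint blocks \<open>{1, 2} \<times> {k}\<close>, and
  each response is a measurable function of its own block.\<close>

lemma (in prob_space) response_indep_vars:
  assumes "indep_vars (\<lambda>_. borel) (\<lambda>(i, k). \<epsilon> i k) ({1, 2} \<times> {1..K})"
  shows "indep_vars (\<lambda>_. borel) (\<lambda>k x. response u W Y \<epsilon> x k) {1..K}"
proof -
  define f where "f k g = (if measure_pmf.expectation (W k) u + g (1, k) \<ge>
      measure_pmf.expectation (Y k) u + g (2, k) then 1 else - 1 :: real)" for k and g :: "nat \<times> nat \<Rightarrow> real"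
  have "indep_vars (\<lambda>k. PiM ({1, 2} \<times> {k}) (\<lambda>_. borel))
      (\<lambda>k x. restrict (\<lambda>i. (case i of (i, k) \<Rightarrow> \<epsilon> i k) x) ({1, 2} \<times> {k})) {1..K}"
    by (rule indep_vars_restrict[OF assms]) (auto simp: disjoint_family_on_def)
  then have "indep_vars (\<lambda>_. borel)
      (\<lambda>k x. f k (restrict (\<lambda>i. (case i of (i, k) \<Rightarrow> \<epsilon> i k) x) ({1, 2} \<times> {k}))) {1..K}"
  proof (rule indep_vars_compose2)
    fix k :: nat
    have [measurable]: "(\<lambda>g. g (i, k)) \<in> borel_measurable (PiM ({1, 2} \<times> {k}) (\<lambda>_. borel))"
      if "i \<in> {1, 2}" for i :: nat
      using that by (intro measurable_component_singleton) auto
    show "f k \<in> borel_measurable (PiM ({1, 2} \<times> {k}) (\<lambda>_. borel))"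
      unfolding f_def by measurable
  qed
  then show ?thesis
    by (simp add: f_def response_def)
qed

text \<open>The difference of two independent Gumbel variables of equal scale is logistic, seen here
  as a race between the exponential variables \<open>E 1\<close> and \<open>E 2\<close>.\<close>

lemma (in prob_space) prob_response:
  fixes W Y :: "nat \<Rightarrow> real pmf" and u :: "real \<Rightarrow> real"
  assumes indep: "indep_vars (\<lambda>_. borel) (\<lambda>(i, k). \<epsilon> i k) ({1, 2} \<times> {1..K})"
    and gumbel: "\<And>i. i \<in> {1, 2} \<Longrightarrow> cdf (distr M borel (\<epsilon> i k)) = gumbel_cdf 0 s"
    and "0 < s" "k \<in> {1..K}" "z \<in> {-1, 1}"
  defines "d \<equiv> (measure_pmf.expectation (W k) u - measure_pmf.expectation (Y k) u) / s"
  shows "prob {x \<in> space M. response u W Y \<epsilon> x k = z} = 1 / (1 + exp (- z * d))"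
proof -
  have rv: "random_variable borel (\<epsilon> i k)" if "i \<in> {1, 2}" for i
    using indep that \<open>k \<in> {1..K}\<close> by (auto simp: indep_vars_def)
  define E where "E i x = exp (- \<epsilon> i k x / s)" for i x
  have [measurable]: "random_variable borel (\<lambda>x. response u W Y \<epsilon> x k)"
    using response_indep_vars[OF indep] \<open>k \<in> {1..K}\<close> unfolding indep_vars_def by blast
  have expo: "distributed M lborel (E i) (exponential_density 1)" if "i \<in> {1, 2}" for i
    unfolding E_def by (rule exp_gumbel_exponential[OF rv[OF that] gumbel[OF that] \<open>0 < s\<close>])
  have "indep_var (PiM {(2, k)} (\<lambda>_. borel)) (\<lambda>x. restrict (\<lambda>i. (case i of (i, k) \<Rightarrow> \<epsilon> i k) x) {(2, k)})
      (PiM {(1, k)} (\<lambda>_. borel)) (\<lambda>x. restrict (\<lambda>i. (case i of (i, k) \<Rightarrow> \<epsilon> i k) x) {(1, k)})"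
    using \<open>k \<in> {1..K}\<close> by (intro indep_var_restrict[OF indep]) auto
  then have "indep_var borel ((\<lambda>g. exp (- g (2, k) / s)) \<circ> (\<lambda>x. restrict (\<lambda>i. (case i of (i, k) \<Rightarrow> \<epsilon> i k) x) {(2, k)}))
      borel ((\<lambda>g. exp (- g (1, k) / s)) \<circ> (\<lambda>x. restrict (\<lambda>i. (case i of (i, k) \<Rightarrow> \<epsilon> i k) x) {(1, k)}))"
    by (rule indep_var_compose) measurable
  then have indep_E: "indep_var borel (E 2) borel (E 1)"
    by (simp add: comp_def E_def[abs_def])
  \<comment> \<open>Ties fall to the value 1, so \<open>- 1\<close> is the strict event and matches
    \<open>prob_exponential_less\<close> with \<open>a = exp d\<close>.\<close>
  have "response u W Y \<epsilon> x k = - 1 \<longleftrightarrow> exp d * E 2 x < E 1 x" for x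
  proof -
    have "exp d * E 2 x < E 1 x \<longleftrightarrow> d - \<epsilon> 2 k x / s < - \<epsilon> 1 k x / s"
      unfolding E_def exp_add[symmetric] by simp
    also have "d - \<epsilon> 2 k x / s = (measure_pmf.expectation (W k) u - measure_pmf.expectation (Y k) u - \<epsilon> 2 k x) / s"
      by (simp add: d_def diff_divide_distrib)
    also have "\<dots> < - \<epsilon> 1 k x / s \<longleftrightarrow>
        measure_pmf.expectation (W k) u - measure_pmf.expectation (Y k) u - \<epsilon> 2 k x < - \<epsilon> 1 k x"
      using \<open>0 < s\<close> by (simp only: divide_less_cancel) auto
    also have "\<dots> \<longleftrightarrow> \<not> measure_pmf.expectation (W k) u + \<epsilon> 1 k x \<ge> measure_pmf.expectation (Y k) u + \<epsilon> 2 k x"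
      by auto
    finally show ?thesis
      by (simp add: response_def)
  qed
  then have minus: "prob {x \<in> space M. response u W Y \<epsilon> x k = - 1} = 1 / (1 + exp d)"
    using prob_exponential_less[OF indep_E expo expo, of "exp d"] by simp
  show ?thesis
  proof (cases "z = -1")
    case True
    then show ?thesis
      using minus by simp
  next
    case False
    then have "z = 1"
      using assms(5) by simp
    have "{x \<in> space M. response u W Y \<epsilon> x k = z} = space M - {x \<in> space M. response u W Y \<epsilon> x k = - 1}"
      unfolding \<open>z = 1\<close> by (auto simp: response_def)
    then have "prob {x \<in> space M. response u W Y \<epsilon> x k = z} = 1 - 1 / (1 + exp d)"
      using minus by (simp add: prob_compl)
    also have "\<dots> = 1 / (1 + exp (- d))"
    proof -
      have "1 - 1 / (1 + t) = 1 / (1 + inverse t)" if "0 < t" for t :: real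
        using that by (simp add: field_simps)
      then show ?thesis
        by (simp add: exp_minus)
    qed
    finally show ?thesis
      using \<open>z = 1\<close> by simp
  qed
qed

subsection \<open>Logistic loss\<close>

text \<open>The second derivative of the loss is at least \<open>w\<close> for arguments of modulus
  below \<open>2 * c\<close>. Subtracting a parabola of curvature \<open>w\<close> leaves a convex
  function, which lies above its tangent at \<open>s\<close>.\<close>

lemma logistic_loss_above_tangent:
  fixes c s x :: real
  assumes "0 < c" "\<bar>s\<bar> \<le> c" "\<bar>x\<bar> \<le> c"
  defines "w \<equiv> 1 / (2 + 2 * exp (2 * c))"
  shows "ln (1 + exp (- s)) - (x - s) / (1 + exp s) + w / 2 * (x - s)\<^sup>2 \<le> ln (1 + exp (- x))"
proof -
  \<comment> \<open>The radius \<open>2 * c\<close> is the one behind the constant \<open>w\<close>,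
    and it puts \<open>s\<close> and \<open>x\<close> in the interior.\<close>
  let ?C = "{- (2 * c)<..<2 * c}"
  define g where "g t = ln (1 + exp (- t)) - w / 2 * (t - s)\<^sup>2" for t
  define g' where "g' t = - 1 / (1 + exp t) - w * (t - s)" for t
  define g'' where "g'' t = exp t / (1 + exp t)\<^sup>2 - w" for t
  have nz: "1 + exp t \<noteq> 0" for t :: real
    using exp_gt_zero[of t] by linarith
  have g: "(g has_real_derivative g' t) (at t)" for t
  proof -
    have "- exp (- t) / (1 + exp (- t)) = - 1 / (1 + exp t)"
      using nz[of t] nz[of "- t"] by (simp add: exp_minus field_simps)
    moreover have "(g has_real_derivative - exp (- t) / (1 + exp (- t)) - w * (t - s)) (at t)"
      unfolding g_def using nz[of "- t"] exp_gt_zero[of "- t"]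
      by (auto intro!: derivative_eq_intros simp: add_pos_pos)
    ultimately show ?thesis
      by (simp add: g'_def)
  qed
  have g': "(g' has_real_derivative g'' t) (at t)" for t
    unfolding g'_def g''_def using nz[of t]
    by (auto intro!: derivative_eq_intros simp: power2_eq_square)
  \<comment> \<open>With \<open>y = exp t\<close>, both 1 and \<open>y * y\<close> are at most
    \<open>y * E\<close>, so \<open>(1 + y)\<^sup>2\<close> is at most
    \<open>y * (2 + 2 * E)\<close>.\<close>
  have g''_nonneg: "0 \<le> g'' t" if "t \<in> ?C" for t
  proof -
    define y where "y = exp t"
    define E where "E = exp (2 * c)"
    have "0 < y" "y \<le> E"
      using that by (auto simp: y_def E_def)
    have "1 = exp t * exp (- t)"
      by (simp add: exp_minus)
    also have "\<dots> \<le> y * E"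
      unfolding y_def E_def using that by (intro mult_left_mono) auto
    finally have "1 \<le> y * E" .
    moreover have "y * y \<le> y * E"
      using \<open>0 < y\<close> \<open>y \<le> E\<close> by simp
    moreover have "(1 + y)\<^sup>2 = 1 + 2 * y + y * y" "y * (2 + 2 * E) = 2 * y + 2 * (y * E)"
      by (simp_all add: power2_eq_square algebra_simps)
    ultimately have "(1 + y)\<^sup>2 \<le> y * (2 + 2 * E)"
      by linarith
    then have "1 * (1 + y)\<^sup>2 / ((1 + y)\<^sup>2 * (2 + 2 * E)) \<le> y * (2 + 2 * E) / ((1 + y)\<^sup>2 * (2 + 2 * E))"
      using \<open>0 < y\<close> \<open>y \<le> E\<close> by (intro divide_right_mono) auto
    then have "1 / (2 + 2 * E) \<le> y / (1 + y)\<^sup>2"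
      using \<open>0 < y\<close> \<open>y \<le> E\<close> by simp
    then show ?thesis
      by (simp add: g''_def w_def y_def E_def)
  qed
  have "convex_on ?C g"
    by (rule f''_ge0_imp_convex[OF _ g g' g''_nonneg]) auto
  moreover have "s \<in> interior ?C" "x \<in> ?C"
    using assms by (auto simp: interior_open)
  ultimately have "g' s * (x - s) \<le> g x - g s"
    using g[of s] by (intro convex_on_imp_above_tangent[of ?C]) (auto intro: has_field_derivative_at_within)
  then show ?thesis
    by (simp add: g_def g'_def)
qed

text \<open>The sign is absorbed by reflecting \<open>s\<close> and \<open>x\<close>. The
  coefficient \<open>z / (1 + exp (z * s))\<close>, minus the derivative of the loss, is the
  variable of \<open>centered_bernoulli_projection_tail\<close>.\<close>

lemma signed_logistic_loss_above_tangent: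
  fixes c s x z :: real
  assumes "0 < c" "\<bar>s\<bar> \<le> c" "\<bar>x\<bar> \<le> c" "z \<in> {-1, 1}"
  shows "ln (1 + exp (- z * s)) - z / (1 + exp (z * s)) * (x - s)
      + 1 / (2 + 2 * exp (2 * c)) / 2 * (x - s)\<^sup>2 \<le> ln (1 + exp (- z * x))"
proof (cases "z = 1")
  case True
  then show ?thesis
    using logistic_loss_above_tangent[OF assms(1-3)] by simp
next
  case False
  then have "z = -1"
    using assms(4) by simp
  moreover have "(- x - - s)\<^sup>2 = (x - s)\<^sup>2"
    by (simp add: power2_commute)
  moreover have "(- x - - s) / (1 + exp (- s)) = - (1 / (1 + exp (- s)) * (x - s))"
    by (simp add: diff_divide_distrib)
  ultimately show ?thesis
    using logistic_loss_above_tangent[of c "- s" "- x"] assms by simp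
qed

section \<open>From the basic inequality to the error at the nodes\<close>

lemma sum_projection_expansion:
  fixes v :: "'j \<Rightarrow> 'k \<Rightarrow> real"
  assumes "\<And>j. j \<in> A \<Longrightarrow> v j k = (\<Sum>i\<in>R. (\<Sum>l\<in>I. e i l * v j l) * e i k)"
  shows "(\<Sum>j\<in>A. c j * v j k) = (\<Sum>i\<in>R. (\<Sum>l\<in>I. e i l * (\<Sum>j\<in>A. c j * v j l)) * e i k)"
proof -
  have "(\<Sum>j\<in>A. c j * v j k) = (\<Sum>j\<in>A. c j * (\<Sum>i\<in>R. (\<Sum>l\<in>I. e i l * v j l) * e i k))"
    by (intro sum.cong refl arg_cong2[where f = "(*)"] assms)
  also have "\<dots> = (\<Sum>i\<in>R. \<Sum>j\<in>A. c j * ((\<Sum>l\<in>I. e i l * v j l) * e i k))"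
    unfolding sum_distrib_left by (rule sum.swap)
  also have "\<dots> = (\<Sum>i\<in>R. (\<Sum>j\<in>A. \<Sum>l\<in>I. c j * (e i l * v j l)) * e i k)"
    by (simp add: sum_distrib_right sum_distrib_left mult.assoc)
  also have "\<dots> = (\<Sum>i\<in>R. (\<Sum>l\<in>I. \<Sum>j\<in>A. c j * (e i l * v j l)) * e i k)"
    by (subst sum.swap) (rule refl)
  also have "\<dots> = (\<Sum>i\<in>R. (\<Sum>l\<in>I. e i l * (\<Sum>j\<in>A. c j * v j l)) * e i k)"
    by (simp add: sum_distrib_left mult_ac)
  finally show ?thesis .
qed

text \<open>As \<open>x\<close> lies in the span of the orthonormal family, only the projection of
  \<open>V\<close> enters the pairing. Young's inequality then absorbs half of the quadratic
  term.\<close>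

lemma norm_square_le_projected_noise:
  fixes x V :: "'k \<Rightarrow> real" and w :: real
  assumes "0 < w"
    and orth: "\<And>i j. i < r \<Longrightarrow> j < r \<Longrightarrow> (\<Sum>k\<in>I. e i k * e j k) = of_bool (i = j)"
    and span: "\<And>k. k \<in> I \<Longrightarrow> x k = (\<Sum>i<r. (\<Sum>l\<in>I. e i l * x l) * e i k)"
    and le: "w / 2 * (\<Sum>k\<in>I. (x k)\<^sup>2) \<le> (\<Sum>k\<in>I. V k * x k)"
  shows "(\<Sum>k\<in>I. (x k)\<^sup>2) \<le> 4 * (\<Sum>i<r. (\<Sum>k\<in>I. e i k * V k)\<^sup>2) / w\<^sup>2"
proof -
  define a where "a i = (\<Sum>l\<in>I. e i l * x l)" for i
  define b where "b i = (\<Sum>k\<in>I. e i k * V k)" for i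
  have expand: "(\<Sum>k\<in>I. f k * x k) = (\<Sum>i<r. a i * (\<Sum>k\<in>I. e i k * f k))" for f
  proof -
    have "(\<Sum>k\<in>I. f k * x k) = (\<Sum>k\<in>I. f k * (\<Sum>i<r. a i * e i k))"
      unfolding a_def by (intro sum.cong refl arg_cong2[where f = "(*)"] span)
    also have "\<dots> = (\<Sum>i<r. a i * (\<Sum>k\<in>I. e i k * f k))"
      unfolding sum_distrib_left by (subst sum.swap) (simp add: mult_ac)
    finally show ?thesis .
  qed
  have S: "(\<Sum>k\<in>I. (x k)\<^sup>2) = (\<Sum>i<r. (a i)\<^sup>2)"
    using expand[of x] by (simp add: a_def power2_eq_square)
  have "(\<Sum>k\<in>I. V k * x k) = (\<Sum>i<r. a i * b i)"
    using expand[of V] by (simp add: b_def)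
  also have "\<dots> \<le> (\<Sum>i<r. w / 4 * (a i)\<^sup>2 + (b i)\<^sup>2 / w)"
  proof (rule sum_mono)
    fix i
    have "0 \<le> (w / 2 * a i - b i)\<^sup>2 / w"
      using \<open>0 < w\<close> by simp
    also have "\<dots> = w / 4 * (a i)\<^sup>2 + (b i)\<^sup>2 / w - a i * b i"
      using \<open>0 < w\<close> by (simp add: power2_eq_square field_simps)
    finally show "a i * b i \<le> w / 4 * (a i)\<^sup>2 + (b i)\<^sup>2 / w"
      by simp
  qed
  also have "\<dots> = w / 4 * (\<Sum>k\<in>I. (x k)\<^sup>2) + (\<Sum>i<r. (b i)\<^sup>2) / w"
    unfolding S by (simp add: sum.distrib sum_distrib_left sum_divide_distrib)
  finally have "w / 4 * (\<Sum>k\<in>I. (x k)\<^sup>2) \<le> (\<Sum>i<r. (b i)\<^sup>2) / w"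
    using le by linarith
  then show ?thesis
    using \<open>0 < w\<close> unfolding b_def by (simp add: field_simps power2_eq_square)
qed

lemma mle_node_error:
  fixes p :: "nat \<Rightarrow> nat \<Rightarrow> real" and e :: "nat \<Rightarrow> nat \<Rightarrow> real"
  assumes "0 < c" "1 \<le> K" "2 \<le> N" "0 < lam"
    and range: "\<And>j. j \<in> {1..N} \<Longrightarrow> \<alpha> j \<in> {0..c}" "\<And>j. j \<in> {1..N} \<Longrightarrow> \<theta> j \<in> {0..c}"
    and first: "\<alpha> 1 = 0" "\<theta> 1 = 0"
    and score: "\<And>k. k \<in> {1..K} \<Longrightarrow> \<bar>\<Sum>j=1..N. p k j * \<alpha> j\<bar> \<le> c"
      "\<And>k. k \<in> {1..K} \<Longrightarrow> \<bar>\<Sum>j=1..N. p k j * \<theta> j\<bar> \<le> c"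
    and z: "\<And>k. k \<in> {1..K} \<Longrightarrow> z k \<in> {-1, 1}"
    and opt: "log_likelihood K N p z \<theta> \<le> log_likelihood K N p z \<alpha>"
    and orth: "\<And>i j. i < r \<Longrightarrow> j < r \<Longrightarrow> (\<Sum>k=1..K. e i k * e j k) = of_bool (i = j)"
    and span: "\<And>j k. j \<in> {2..N} \<Longrightarrow> k \<in> {1..K} \<Longrightarrow> p k j = (\<Sum>i<r. (\<Sum>l=1..K. e i l * p l j) * e i k)"
    and noise: "(\<Sum>i<r. (\<Sum>k=1..K. e i k * (z k / (1 + exp (z k * (\<Sum>j=1..N. p k j * \<theta> j)))))\<^sup>2) \<le> T"
    and j: "j \<in> {1..N}"
  defines "w \<equiv> 1 / (2 + 2 * exp (2 * c))"
  shows "\<bar>\<alpha> j - \<theta> j\<bar> \<le> sqrt (4 * (T / (w\<^sup>2 * real K)) + lam * (c * sqrt (real (N - 1)))\<^sup>2)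
    / sqrt (min_eigenvalue (Sigma_D K N p + lam \<cdot>\<^sub>m 1\<^sub>m (N - 1)))"
proof -
  let ?m = "min_eigenvalue (Sigma_D K N p + lam \<cdot>\<^sub>m 1\<^sub>m (N - 1))"
  define s where "s k = (\<Sum>j=1..N. p k j * \<theta> j)" for k
  define s' where "s' k = (\<Sum>j=1..N. p k j * \<alpha> j)" for k
  define V where "V k = z k / (1 + exp (z k * s k))" for k
  define d where "d j = \<alpha> j - \<theta> j" for j
  define x where "x k = (\<Sum>j=2..N. d j * p k j)" for k
  have "0 < w"
    by (simp add: w_def add_pos_pos)
  \<comment> \<open>Both vectors vanish at index 1, so the score difference involves only the
    columns kept in the design matrix.\<close>
  have "{1..N} = insert 1 {2..N}"
    using \<open>2 \<le> N\<close> by auto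
  then have diff: "s' k - s k = x k" for k
    using first by (simp add: s_def s'_def x_def d_def sum_subtractf algebra_simps)
  have ll: "log_likelihood K N p z \<phi> = - (\<Sum>k=1..K. ln (1 + exp (- z k * (\<Sum>j=1..N. p k j * \<phi> j))))" for \<phi>
    by (simp add: log_likelihood_def sum_distrib_left mult.assoc)
  have "(\<Sum>k=1..K. ln (1 + exp (- z k * s k)) - V k * x k + w / 2 * (x k)\<^sup>2)
      \<le> (\<Sum>k=1..K. ln (1 + exp (- z k * s' k)))"
  proof (rule sum_mono)
    fix k assume k: "k \<in> {1..K}"
    show "ln (1 + exp (- z k * s k)) - V k * x k + w / 2 * (x k)\<^sup>2 \<le> ln (1 + exp (- z k * s' k))"
      using signed_logistic_loss_above_tangent[OF \<open>0 < c\<close> score(2)[OF k] score(1)[OF k] z[OF k]]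
      unfolding s_def[symmetric] s'_def[symmetric] diff V_def[symmetric] w_def[symmetric] .
  qed
  \<comment> \<open>The likelihood comparison puts the loss at \<open>\<theta>\<close> on both
    sides, where it cancels.\<close>
  also have "\<dots> \<le> (\<Sum>k=1..K. ln (1 + exp (- z k * s k)))"
    using opt unfolding ll s_def s'_def by simp
  finally have basic: "w / 2 * (\<Sum>k=1..K. (x k)\<^sup>2) \<le> (\<Sum>k=1..K. V k * x k)"
    by (simp add: sum.distrib sum_subtractf sum_distrib_left)
  have span_x: "x k = (\<Sum>i<r. (\<Sum>l=1..K. e i l * x l) * e i k)" if "k \<in> {1..K}" for k
    unfolding x_def by (rule sum_projection_expansion[where v = "\<lambda>j k. p k j"]) (rule span[OF _ that])
  have "(\<Sum>k=1..K. (x k)\<^sup>2) \<le> 4 * (\<Sum>i<r. (\<Sum>k=1..K. e i k * V k)\<^sup>2) / w\<^sup>2"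
    by (rule norm_square_le_projected_noise[OF \<open>0 < w\<close> orth span_x basic])
  also have "\<dots> \<le> 4 * T / w\<^sup>2"
    using noise unfolding V_def s_def by (intro divide_right_mono mult_left_mono) auto
  finally have x_le: "(\<Sum>k=1..K. (x k)\<^sup>2) / real K \<le> 4 * (T / (w\<^sup>2 * real K))"
    using divide_right_mono[of _ _ "real K"] by fastforce
  have shift: "(\<Sum>j=2..N. f j) = (\<Sum>i<N - 1. f (i + 2))" for f :: "nat \<Rightarrow> real"
    by (rule sum.reindex_bij_witness[of _ "\<lambda>i. i + 2" "\<lambda>j. j - 2"]) (auto simp del: add_2_eq_Suc')
  \<comment> \<open>Node values lie in \<open>{0..c}\<close>, so each of the \<open>N - 1\<close>
    differences has modulus at most \<open>c\<close>.\<close>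
  have "(\<Sum>i<N - 1. (d (i + 2))\<^sup>2) \<le> (\<Sum>i<N - 1. c\<^sup>2)"
  proof (rule sum_mono)
    fix i assume "i \<in> {..<N - 1}"
    then have "i + 2 \<in> {1..N}"
      by auto
    then have "\<bar>d (i + 2)\<bar> \<le> c"
      using range[of "i + 2"] by (auto simp: d_def abs_le_iff)
    then show "(d (i + 2))\<^sup>2 \<le> c\<^sup>2"
      by (rule power2_le_iff_abs_le[THEN iffD2, rotated]) (use \<open>0 < c\<close> in simp)
  qed
  also have "\<dots> = (c * sqrt (real (N - 1)))\<^sup>2"
    by (simp add: power_mult_distrib)
  finally have d_le: "(\<Sum>i<N - 1. (d (i + 2))\<^sup>2) \<le> (c * sqrt (real (N - 1)))\<^sup>2" .
  have m: "0 < ?m"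
    using min_eigenvalue_regularized_Sigma_D(1)[OF \<open>1 \<le> K\<close> \<open>2 \<le> N\<close>] \<open>0 < lam\<close> by (rule less_le_trans[rotated])
  \<comment> \<open>The error at one node is at most the Euclidean norm of the error vector.\<close>
  have "(d j)\<^sup>2 \<le> (\<Sum>i<N - 1. (d (i + 2))\<^sup>2)"
  proof (cases "j = 1")
    case True
    then show ?thesis
      using first by (simp add: d_def sum_nonneg)
  next
    case False
    then have "j \<in> {2..N}"
      using j by auto
    then have "(d j)\<^sup>2 \<le> (\<Sum>j=2..N. (d j)\<^sup>2)"
      by (intro member_le_sum) auto
    then show ?thesis
      unfolding shift .
  qed
  then have "?m * (d j)\<^sup>2 \<le> ?m * (\<Sum>i<N - 1. (d (i + 2))\<^sup>2)"
    using m by (intro mult_left_mono) auto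
  also have "\<dots> \<le> (\<Sum>k=1..K. (x k)\<^sup>2) / real K + lam * (\<Sum>i<N - 1. (d (i + 2))\<^sup>2)"
    using min_eigenvalue_regularized_Sigma_D(2)[OF \<open>1 \<le> K\<close> \<open>2 \<le> N\<close>, where v = "\<lambda>i. d (i + 2)"]
    unfolding x_def shift .
  also have "\<dots> \<le> 4 * (T / (w\<^sup>2 * real K)) + lam * (c * sqrt (real (N - 1)))\<^sup>2"
    using x_le d_le \<open>0 < lam\<close> by (intro add_mono mult_left_mono) auto
  finally have "sqrt (?m * (d j)\<^sup>2) \<le> sqrt (4 * (T / (w\<^sup>2 * real K)) + lam * (c * sqrt (real (N - 1)))\<^sup>2)"
    by (rule real_sqrt_le_mono)
  then show ?thesis
    using m by (simp add: real_sqrt_mult d_def[symmetric] pos_le_divide_eq mult.commute)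
qed

text \<open>The square of the right side is \<open>2 * a + b\<close> plus a cross term of at least
  \<open>2 * a\<close>.\<close>

lemma sqrt_add_sqrt_ge:
  fixes a b :: real
  assumes "0 \<le> a" "0 \<le> b"
  shows "sqrt (4 * a + b) \<le> sqrt a + sqrt (a + b)"
proof (rule real_le_lsqrt)
  have "sqrt a * sqrt a \<le> sqrt a * sqrt (a + b)"
    using assms by (intro mult_left_mono real_sqrt_le_mono) auto
  then show "4 * a + b \<le> (sqrt a + sqrt (a + b))\<^sup>2"
    using assms by (simp add: power2_sum)
qed (use assms in auto)

subsection \<open>Breakpoints and feasible points\<close>

lemma nth_point_strict_mono_on: "strict_mono_on {1..card S} (nth_point S)"
  unfolding strict_mono_on_def nth_point_def
  by (auto intro!: sorted_wrt_nth_less[OF strict_sorted_list_of_set])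

lemma nth_point_bij_betw:
  assumes "finite S"
  shows "bij_betw (nth_point S) {1..card S} S"
proof -
  have "bij_betw (\<lambda>j. j - 1) {1..card S} {..<card S}"
    by (rule bij_betw_byWitness[of _ "\<lambda>j. j + 1"]) auto
  moreover have "bij_betw ((!) (sorted_list_of_set S)) {..<card S} S"
    by (rule bij_betw_nth) (use assms in auto)
  ultimately have "bij_betw ((!) (sorted_list_of_set S) \<circ> (\<lambda>j. j - 1)) {1..card S} S"
    by (rule bij_betw_trans)
  then show ?thesis
    by (simp add: comp_def nth_point_def[abs_def])
qed

lemma nth_point_least_greatest:
  assumes "finite S" "a \<in> S" "b \<in> S" "S \<subseteq> {a..b}"
  shows "nth_point S 1 = a" "nth_point S (card S) = b"
proof -
  have bij: "bij_betw (nth_point S) {1..card S} S"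
    using assms(1) by (rule nth_point_bij_betw)
  have mono: "nth_point S i \<le> nth_point S j" if "1 \<le> i" "i \<le> j" "j \<le> card S" for i j
    using strict_mono_onD[OF nth_point_strict_mono_on, of i S j] that by (cases "i = j") auto
  have mem: "nth_point S j \<in> S" if "j \<in> {1..card S}" for j
    using bij that by (rule bij_betwE[THEN bspec])
  have attained: "\<exists>j\<in>{1..card S}. nth_point S j = x" if "x \<in> S" for x
  proof -
    have "x \<in> nth_point S ` {1..card S}"
      using that bij_betw_imp_surj_on[OF bij] by simp
    then show ?thesis
      by auto
  qed
  obtain i where i: "i \<in> {1..card S}" "nth_point S i = a"
    using attained[OF assms(2)] by blast
  have "nth_point S 1 \<le> a" "a \<le> nth_point S 1"
    using mono[of 1 i] mem[of 1] i assms(4) by auto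
  then show "nth_point S 1 = a"
    by simp
  obtain j where j: "j \<in> {1..card S}" "nth_point S j = b"
    using attained[OF assms(3)] by blast
  have "b \<le> nth_point S (card S)" "nth_point S (card S) \<le> b"
    using mono[of j "card S"] mem[of "card S"] j assms(4) by auto
  then show "nth_point S (card S) = b"
    by simp
qed

text \<open>Slopes decrease and the last one is nonnegative, so all are, and \<open>\<alpha>\<close>
  climbs from 0 to \<open>\<gamma>\<close>.\<close>

lemma mle_feasible_bounds:
  assumes y: "strict_mono_on {1..N} y" and "2 \<le> N" and feas: "mle_feasible N y L c \<alpha> \<beta> \<gamma>"
    and j: "j \<in> {1..N}"
  shows "0 \<le> \<alpha> j" "\<alpha> j \<le> \<gamma>"
proof -
  have slope: "\<And>i. i \<in> {1..N - 1} \<Longrightarrow> \<beta> i = (\<alpha> (i + 1) - \<alpha> i) / (y (i + 1) - y i)"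
    and anti: "\<And>i. i \<in> {1..N - 2} \<Longrightarrow> \<beta> (i + 1) \<le> \<beta> i"
    and last: "0 \<le> \<beta> (N - 1)" and ends: "\<alpha> 1 = 0" "\<alpha> N = \<gamma>"
    using feas by (auto simp: mle_feasible_def)
  have \<beta>_nonneg: "0 \<le> \<beta> i" if "i \<le> N - 1" "1 \<le> i" for i
    using that
  proof (induction i rule: inc_induct)
    case (step i)
    then have "0 \<le> \<beta> (i + 1)" "\<beta> (i + 1) \<le> \<beta> i"
      using anti[of i] by auto
    then show ?case
      by linarith
  qed (rule last)
  have inc: "\<alpha> i \<le> \<alpha> (Suc i)" if "1 \<le> i" "i < N" for i
  proof -
    have "0 < y (i + 1) - y i"
      using strict_mono_onD[OF y, of i "i + 1"] that by simp
    moreover have "0 \<le> (\<alpha> (i + 1) - \<alpha> i) / (y (i + 1) - y i)"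
      using slope[of i] \<beta>_nonneg[of i] that by auto
    ultimately show ?thesis
      by (simp add: zero_le_divide_iff)
  qed
  have mono: "\<alpha> i \<le> \<alpha> k" if "i \<le> k" "1 \<le> i" "k \<le> N" for i k
    using that
  proof (induction rule: dec_induct)
    case (step k)
    then show ?case
      using inc[of k] by simp
  qed simp
  show "0 \<le> \<alpha> j" "\<alpha> j \<le> \<gamma>"
    using mono[of 1 j] mono[of j N] ends j by auto
qed

text \<open>Makes the truth a competitor in the MLE: concavity orders the slopes, the Lipschitz
  bound limits the first and monotonicity gives the sign of the last.\<close>

lemma scaled_utility_mle_feasible:
  assumes y: "strict_mono_on {1..N} y" and "2 \<le> N" and y_ends: "y 1 = 0" "y N = b"
    and u: "u \<in> utility_class b L" and \<sigma>: "0 < \<sigma>" "1 / \<sigma> \<le> c"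
  defines "\<alpha> \<equiv> \<lambda>j. u (y j) / \<sigma>"
  shows "mle_feasible N y L c \<alpha> (\<lambda>j. (\<alpha> (j + 1) - \<alpha> j) / (y (j + 1) - y j)) (1 / \<sigma>)"
proof -
  have mono: "mono_on {0..b} u" and concave: "convex_on {0..b} (\<lambda>x. - u x)"
    and lip: "L-lipschitz_on {0..b} u" and u_ends: "u 0 = 0" "u b = 1"
    using u by (auto simp: utility_class_def concave_on_def)
  have less: "y i < y j" if "1 \<le> i" "i < j" "j \<le> N" for i j
    using strict_mono_onD[OF y] that by auto
  have mem: "y j \<in> {0..b}" if "1 \<le> j" "j \<le> N" for j
    using less[of 1 j] less[of j N] that y_ends by (cases "j = 1"; cases "j = N") auto
  have "(\<alpha> (j + 2) - \<alpha> (j + 1)) / (y (j + 2) - y (j + 1)) \<le> (\<alpha> (j + 1) - \<alpha> j) / (y (j + 1) - y j)"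
    if j: "j \<in> {1..N - 2}" for j
  proof -
    have lt: "y j < y (j + 1)" "y (j + 1) < y (j + 2)"
      using j less[of j "j + 1"] less[of "j + 1" "j + 2"] by auto
    have "1 \<le> j" "j \<le> N" "1 \<le> j + 2" "j + 2 \<le> N"
      using j by auto
    then have mems: "y j \<in> {0..b}" "y (j + 2) \<in> {0..b}"
      by (blast intro: mem)+
    from convex_on_slope_le[OF concave mems lt]
    have "- ((u (y (j + 1)) - u (y j)) / (y (j + 1) - y j)) \<le> - ((u (y (j + 2)) - u (y (j + 1))) / (y (j + 2) - y (j + 1)))"
      using lt by (auto simp: field_simps)
    then have "(u (y (j + 2)) - u (y (j + 1))) / (y (j + 2) - y (j + 1)) / \<sigma>
        \<le> (u (y (j + 1)) - u (y j)) / (y (j + 1) - y j) / \<sigma>"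
      using \<sigma> by (intro divide_right_mono) auto
    then show ?thesis
      by (simp add: \<alpha>_def diff_divide_distrib[symmetric] mult.commute)
  qed
  moreover have "(\<alpha> 2 - \<alpha> 1) / (y 2 - y 1) \<le> L * (1 / \<sigma>)"
  proof -
    have "u (y 2) - u (y 1) \<le> L * (y 2 - y 1)"
      using lipschitz_onD[OF lip mem[of 2] mem[of 1]] less[of 1 2] \<open>2 \<le> N\<close> by (simp add: dist_real_def)
    then have "(u (y 2) - u (y 1)) / (y 2 - y 1) / \<sigma> \<le> L / \<sigma>"
      using less[of 1 2] \<open>2 \<le> N\<close> \<sigma> by (intro divide_right_mono) (auto simp: pos_divide_le_eq)
    then show ?thesis
      by (simp add: \<alpha>_def diff_divide_distrib[symmetric] mult.commute)
  qed
  moreover have "0 \<le> (\<alpha> N - \<alpha> (N - 1)) / (y N - y (N - 1))"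
  proof -
    have N: "1 \<le> N - 1" "N - 1 < N" "N - 1 \<le> N" "1 \<le> N"
      using \<open>2 \<le> N\<close> by auto
    have lt: "y (N - 1) < y N"
      using N by (intro less) auto
    have "u (y (N - 1)) \<le> u (y N)"
      by (rule mono_onD[OF mono mem[OF N(1,3)] mem[OF N(4) order_refl] less_imp_le[OF lt]])
    then have "u (y (N - 1)) / \<sigma> \<le> u (y N) / \<sigma>"
      using \<sigma> by (intro divide_right_mono) auto
    then show ?thesis
      using lt by (simp add: \<alpha>_def)
  qed
  ultimately show ?thesis
    unfolding mle_feasible_def using \<sigma> \<open>2 \<le> N\<close> y_ends u_ends
    by (auto simp: \<alpha>_def numeral_2_eq_2)
qed

text \<open>The estimate differs from the interpolant of the true node values by at most the node
  error. That interpolant differs from the truth by at most one increment of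
  \<open>u / \<sigma>\<close> between neighbouring nodes.\<close>

lemma d_K_le_mesh_plus_node_error:
  assumes y: "strict_mono_on {1..N} y" and "2 \<le> N" and y_ends: "y 1 = 0" "y N = b"
    and u: "u \<in> utility_class b L" and \<sigma>: "0 < \<sigma>" "1 / \<sigma> \<le> c" and "0 \<le> L"
    and feas: "mle_feasible N y L c \<alpha> \<beta> \<gamma>"
    and D: "\<And>j. j \<in> {1..N} \<Longrightarrow> \<bar>\<alpha> j - u (y j) / \<sigma>\<bar> \<le> D"
  shows "d_K N y (scaled_u_MLE N y \<alpha> \<gamma>) (\<lambda>t. u t / \<sigma>) \<le> L * c * mesh N y + D"
proof -
  have mono: "mono_on {0..b} u" and lip: "L-lipschitz_on {0..b} u"
    using u by (auto simp: utility_class_def)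
  have less: "y i < y j" if "1 \<le> i" "i < j" "j \<le> N" for i j
    using strict_mono_onD[OF y] that by auto
  have mem: "y j \<in> {0..b}" if "1 \<le> j" "j \<le> N" for j
    using less[of 1 j] less[of j N] that y_ends by (cases "j = 1"; cases "j = N") auto
  have "\<bar>scaled_u_MLE N y \<alpha> \<gamma> x - u x / \<sigma>\<bar> \<le> L * c * mesh N y + D" if x: "x \<in> {y 1..y N}" for x
  proof -
    obtain j where j: "j \<in> {1..N - 1}" "x \<in> {y j..y (j + 1)}"
    proof -
      \<comment> \<open>The same index as in \<open>pl_interp\<close>; the restriction to
        \<open>{1..N - 1}\<close> assigns \<open>y N\<close> to the last segment.\<close>
      define j where "j = Max {j\<in>{1..N - 1}. y j \<le> x}"
      have fin: "finite {j\<in>{1..N - 1}. y j \<le> x}"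
        by simp
      moreover have "1 \<in> {j\<in>{1..N - 1}. y j \<le> x}"
        using x \<open>2 \<le> N\<close> by simp
      ultimately have "j \<in> {j\<in>{1..N - 1}. y j \<le> x}"
        unfolding j_def by (intro Max_in) auto
      moreover have "x \<le> y (j + 1)"
      proof (rule ccontr)
        assume "\<not> x \<le> y (j + 1)"
        moreover have "j + 1 \<le> N"
          using \<open>j \<in> _\<close> \<open>2 \<le> N\<close> by auto
        moreover have "j + 1 \<noteq> N"
          using \<open>\<not> x \<le> y (j + 1)\<close> x by auto
        ultimately have "j + 1 \<in> {j\<in>{1..N - 1}. y j \<le> x}"
          by auto
        then have "j + 1 \<le> j"
          unfolding j_def using fin by (intro Max_ge) auto
        then show False
          by simp
      qed
      ultimately show thesis
        by (intro that) auto
    qed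
    define h where "h = y (j + 1) - y j"
    define t where "t = (x - y j) / h"
    have h: "0 < h"
    proof -
      have "j + 1 \<le> N"
        using j(1) \<open>2 \<le> N\<close> by auto
      then show ?thesis
        using j less[of j "j + 1"] by (simp add: h_def)
    qed
    have t: "0 \<le> t" "t \<le> 1" "x - y j = t * h"
      using j h by (auto simp: t_def h_def)
    have jN: "j \<in> {1..N}" "j + 1 \<in> {1..N}"
      using j \<open>2 \<le> N\<close> by auto
    define v where "v i = u (y i) / \<sigma>" for i
    have scaled: "scaled_u_MLE N y \<alpha> \<gamma> x = (1 - t) * \<alpha> j + t * \<alpha> (j + 1)"
    \<comment> \<open>For \<open>\<gamma> = 0\<close> feasibility forces all node values to 0, so
      the convention for an infinite scale agrees with interpolation.\<close>
    proof (cases "\<gamma> = 0")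
      case True
      then have "\<alpha> i = 0" if "i \<in> {1..N}" for i
        using mle_feasible_bounds[OF y \<open>2 \<le> N\<close> feas that] by simp
      then have "\<alpha> j = 0" "\<alpha> (j + 1) = 0"
        using jN by blast+
      then show ?thesis
        using True by (simp add: scaled_u_MLE_def)
    next
      case False
      have "u_MLE N y \<alpha> \<gamma> x = \<alpha> j / \<gamma> + (\<alpha> (j + 1) / \<gamma> - \<alpha> j / \<gamma>) / h * (t * h)"
        unfolding u_MLE_def h_def t(3)[unfolded h_def, symmetric] by (rule pl_interp_segment[OF y j])
      also have "\<dots> = ((1 - t) * \<alpha> j + t * \<alpha> (j + 1)) / \<gamma>"
      proof -
        have "q / h * (t * h) = t * q" for q
          using h by simp
        then show ?thesis
          by (simp only:) (simp add: diff_divide_distrib add_divide_distrib algebra_simps)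
      qed
      finally show ?thesis
        using False by (simp add: scaled_u_MLE_def sigma_MLE_def)
    qed
    have x_mem: "x \<in> {0..b}" "y j \<in> {0..b}" "y (j + 1) \<in> {0..b}"
      using x y_ends mem[of j] mem[of "j + 1"] jN by auto
    have between: "v j \<le> u x / \<sigma>" "u x / \<sigma> \<le> v (j + 1)"
      unfolding v_def using mono_onD[OF mono x_mem(2,1)] mono_onD[OF mono x_mem(1,3)] j \<sigma>
      by (auto intro!: divide_right_mono)
    \<comment> \<open>By monotonicity the truth and the interpolant both lie between the two node
      values.\<close>
    have "\<bar>u x / \<sigma> - ((1 - t) * v j + t * v (j + 1))\<bar> \<le> v (j + 1) - v j"
    proof -
      have "0 \<le> t * (v (j + 1) - v j)" "0 \<le> (1 - t) * (v (j + 1) - v j)"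
        using t between by auto
      then show ?thesis
        using between by (simp add: algebra_simps abs_le_iff)
    qed
    also have "v (j + 1) - v j \<le> L * c * mesh N y"
    proof -
      have "u (y (j + 1)) - u (y j) \<le> L * h"
        using lipschitz_onD[OF lip x_mem(3,2)] h by (simp add: dist_real_def h_def)
      then have "v (j + 1) - v j \<le> L * h * (1 / \<sigma>)"
        using \<sigma> by (simp add: v_def diff_divide_distrib[symmetric] divide_right_mono)
      also have "\<dots> \<le> L * h * c"
        using \<sigma> \<open>0 \<le> L\<close> h by (intro mult_left_mono) auto
      also have "h \<le> mesh N y"
        unfolding mesh_def h_def using j
        by (intro Max_ge) (auto intro!: image_eqI[of _ _ "j + 1"])
      then have "L * h * c \<le> L * c * mesh N y"
        using \<open>0 \<le> L\<close> \<sigma> mult_left_mono[of h "mesh N y" "L * c"] by (simp add: mult_ac order_trans[of 0 "1 / \<sigma>" c])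
      finally show ?thesis .
    qed
    finally have "\<bar>u x / \<sigma> - ((1 - t) * v j + t * v (j + 1))\<bar> \<le> L * c * mesh N y" .
    moreover have "\<bar>(1 - t) * (\<alpha> j - v j) + t * (\<alpha> (j + 1) - v (j + 1))\<bar> \<le> D"
    proof -
      have "\<bar>(1 - t) * (\<alpha> j - v j) + t * (\<alpha> (j + 1) - v (j + 1))\<bar>
          \<le> (1 - t) * \<bar>\<alpha> j - v j\<bar> + t * \<bar>\<alpha> (j + 1) - v (j + 1)\<bar>"
        using t abs_triangle_ineq[of "(1 - t) * (\<alpha> j - v j)" "t * (\<alpha> (j + 1) - v (j + 1))"]
        by (simp add: abs_mult)
      also have "\<dots> \<le> (1 - t) * D + t * D"
        unfolding v_def using t j by (intro add_mono mult_left_mono D) auto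
      finally show ?thesis
        by (simp add: algebra_simps)
    qed
    ultimately show ?thesis
      unfolding scaled by (simp add: algebra_simps abs_le_iff)
  qed
  moreover have "{y 1..y N} \<noteq> {}"
    using less[of 1 N] \<open>2 \<le> N\<close> by simp
  ultimately show ?thesis
    unfolding d_K_def by (intro cSUP_least) auto
qed

lemma breakpoints_props:
  assumes "0 < b"
    and "\<And>k. k \<in> {1..K} \<Longrightarrow> finite (set_pmf (W k)) \<and> set_pmf (W k) \<subseteq> {0..b}"
    and "\<And>k. k \<in> {1..K} \<Longrightarrow> finite (set_pmf (Y k)) \<and> set_pmf (Y k) \<subseteq> {0..b}"
  shows "finite (breakpoints b K W Y)" "breakpoints b K W Y \<subseteq> {0..b}" "2 \<le> card (breakpoints b K W Y)"
proof -
  show fin: "finite (breakpoints b K W Y)"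
    unfolding breakpoints_def using assms by (intro finite_UnI finite_UN_I) auto
  show "breakpoints b K W Y \<subseteq> {0..b}"
    unfolding breakpoints_def using assms(1)
    by (intro Un_least UN_least conjunct2[OF assms(2)] conjunct2[OF assms(3)]) auto
  have "card {0, b} \<le> card (breakpoints b K W Y)"
    by (rule card_mono[OF fin]) (auto simp: breakpoints_def)
  then show "2 \<le> card (breakpoints b K W Y)"
    using assms(1) by simp
qed

section \<open>Expectations as sums over breakpoints\<close>

lemma sum_pmf_nth_point:
  assumes "finite S" "set_pmf q \<subseteq> S"
  shows "(\<Sum>j=1..card S. pmf q (nth_point S j) * f (nth_point S j)) = measure_pmf.expectation q f"
proof -
  have "measure_pmf.expectation q f = (\<Sum>a\<in>S. f a * pmf q a)"
    using assms by (intro integral_measure_pmf_real) auto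
  also have "\<dots> = (\<Sum>j=1..card S. f (nth_point S j) * pmf q (nth_point S j))"
    using sum.reindex_bij_betw[OF nth_point_bij_betw[OF assms(1)], of "\<lambda>a. f a * pmf q a"] by simp
  finally show ?thesis
    by (simp add: mult.commute)
qed

text \<open>The score is a difference of two expectations that both lie in \<open>{0..c}\<close>,
  hence the bound \<open>c\<close> instead of \<open>2 * c\<close>.\<close>

lemma abs_prob_diff_score_le:
  assumes S: "finite S" "set_pmf (W k) \<subseteq> S" "set_pmf (Y k) \<subseteq> S"
    and \<alpha>: "\<And>j. j \<in> {1..card S} \<Longrightarrow> \<alpha> j \<in> {0..c}"
  shows "\<bar>\<Sum>j=1..card S. prob_diff W Y (nth_point S) k j * \<alpha> j\<bar> \<le> c"
proof -
  have *: "(\<Sum>j=1..card S. pmf q (nth_point S j) * \<alpha> j) \<in> {0..c}" if "set_pmf q \<subseteq> S" for q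
  proof -
    have "(\<Sum>j=1..card S. pmf q (nth_point S j) * \<alpha> j) \<le> (\<Sum>j=1..card S. pmf q (nth_point S j) * c)"
      using \<alpha> by (intro sum_mono mult_left_mono) auto
    also have "\<dots> = c"
      using sum_pmf_nth_point[OF S(1) that, of "\<lambda>_. c"] by simp
    finally show ?thesis
      using \<alpha> by (auto intro!: sum_nonneg)
  qed
  have "(\<Sum>j=1..card S. prob_diff W Y (nth_point S) k j * \<alpha> j)
      = (\<Sum>j=1..card S. pmf (W k) (nth_point S j) * \<alpha> j) - (\<Sum>j=1..card S. pmf (Y k) (nth_point S j) * \<alpha> j)"
    by (simp add: prob_diff_def left_diff_distrib sum_subtractf)
  then show ?thesis
    using *[OF S(2)] *[OF S(3)] by (simp add: abs_le_iff)
qed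

subsection \<open>Error bound\<close>

text \<open>The bound is asked of every optimal solution, so any choice of an MLE is covered. The
  proof also shows the event measurable, so its \<open>measure\<close> is a genuine
  probability.\<close>

theorem theorem3:
  fixes M :: "'a measure"
    and b L c \<sigma> lam \<delta> :: real
    and K :: nat
    and W Y :: "nat \<Rightarrow> real pmf"
    and u :: "real \<Rightarrow> real"
    and \<epsilon> :: "nat \<Rightarrow> nat \<Rightarrow> 'a \<Rightarrow> real"
  assumes "0 < b" "0 < L" "0 < c" "1 \<le> K"
    and "\<And>k. k \<in> {1..K} \<Longrightarrow> finite (set_pmf (W k)) \<and> set_pmf (W k) \<subseteq> {0..b}"
    and "\<And>k. k \<in> {1..K} \<Longrightarrow> finite (set_pmf (Y k)) \<and> set_pmf (Y k) \<subseteq> {0..b}"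
    and "u \<in> utility_class b L"
    and "\<sigma> \<ge> 1 / c"
    and "prob_space M"
    and "prob_space.indep_vars M (\<lambda>_. borel) (\<lambda>(i, k). \<epsilon> i k) ({1, 2} \<times> {1..K})"
    and "\<And>i k. i \<in> {1, 2} \<Longrightarrow> k \<in> {1..K} \<Longrightarrow> cdf (distr M borel (\<epsilon> i k)) = gumbel_cdf 0 \<sigma>"
    and "0 < lam" "0 < \<delta>" "\<delta> < 1"
  shows
    "let S = breakpoints b K W Y;
         N = card S;
         y = nth_point S;
         p = prob_diff W Y y;
         \<Sigma> = Sigma_D K N p;
         R = real (vec_space.rank (N - 1) \<Sigma>);
         w = 1 / (2 + 2 * exp (2 * c));
         A = (R + 2 * sqrt (- R * ln \<delta>) - 2 * ln \<delta>) / (w\<^sup>2 * real K);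
         bound = L * c * mesh N y
           + (sqrt A + sqrt (A + lam * (c * sqrt (real (N - 1)))\<^sup>2))
             / sqrt (min_eigenvalue (\<Sigma> + lam \<cdot>\<^sub>m 1\<^sub>m (N - 1)))
     in measure M {x \<in> space M. \<forall>\<alpha> \<beta> \<gamma>. mle_optimal K N y p L c (response u W Y \<epsilon> x) \<alpha> \<beta> \<gamma> \<longrightarrow>
          d_K N y (scaled_u_MLE N y \<alpha> \<gamma>) (\<lambda>t. u t / \<sigma>) \<le> bound} \<ge> 1 - \<delta>"
proof -
  interpret prob_space M
    by fact
  define S where "S = breakpoints b K W Y"
  define N where "N = card S"
  define y where "y = nth_point S"
  define p where "p = prob_diff W Y y"
  define R where "R = vec_space.rank (N - 1) (Sigma_D K N p)"
  define w where "w = 1 / (2 + 2 * exp (2 * c))"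
  define A where "A = (real R + 2 * sqrt (- real R * ln \<delta>) - 2 * ln \<delta>) / (w\<^sup>2 * real K)"
  define B where "B = lam * (c * sqrt (real (N - 1)))\<^sup>2"
  define m where "m = min_eigenvalue (Sigma_D K N p + lam \<cdot>\<^sub>m 1\<^sub>m (N - 1))"
  define bound where "bound = L * c * mesh N y + (sqrt A + sqrt (A + B)) / sqrt m"
  define \<theta> where "\<theta> j = u (y j) / \<sigma>" for j
  define s where "s k = (\<Sum>j=1..N. p k j * \<theta> j)" for k
  \<comment> \<open>Tail threshold for \<open>t = - ln \<delta>\<close>: the numerator of
    \<open>A\<close> without its nonnegative middle term.\<close>
  define T where "T = real R + 2 * (- ln \<delta>)"
  note support = assms(5,6)
  have S: "finite S" "S \<subseteq> {0..b}" and N: "2 \<le> N"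
    unfolding N_def S_def by (rule breakpoints_props[OF \<open>0 < b\<close>]; rule support; assumption)+
  have ends_S: "0 \<in> S" "b \<in> S" and supp_W: "\<And>k. k \<in> {1..K} \<Longrightarrow> set_pmf (W k) \<subseteq> S"
    and supp_Y: "\<And>k. k \<in> {1..K} \<Longrightarrow> set_pmf (Y k) \<subseteq> S"
    by (auto simp: S_def breakpoints_def)
  have y: "strict_mono_on {1..N} y" and y_ends: "y 1 = 0" "y N = b"
    unfolding N_def y_def using nth_point_strict_mono_on nth_point_least_greatest[OF S(1) ends_S S(2)] by blast+
  have \<sigma>: "0 < \<sigma>" "1 / \<sigma> \<le> c"
  proof -
    have "0 < 1 / c"
      using \<open>0 < c\<close> by simp
    then show "0 < \<sigma>"
      using \<open>\<sigma> \<ge> 1 / c\<close> by linarith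
    then show "1 / \<sigma> \<le> c"
      using \<open>\<sigma> \<ge> 1 / c\<close> \<open>0 < c\<close> by (simp add: field_simps)
  qed
  have \<theta>_feasible: "mle_feasible N y L c \<theta> (\<lambda>j. (\<theta> (j + 1) - \<theta> j) / (y (j + 1) - y j)) (1 / \<sigma>)"
    unfolding \<theta>_def by (rule scaled_utility_mle_feasible[OF y N y_ends \<open>u \<in> _\<close> \<sigma>])
  have range: "\<alpha> j \<in> {0..c}" if "mle_feasible N y L c \<alpha> \<beta> \<gamma>" "j \<in> {1..N}" for \<alpha> \<beta> \<gamma> j
  proof -
    have "\<gamma> \<le> c"
      using that(1) by (simp add: mle_feasible_def)
    then show ?thesis
      using mle_feasible_bounds[OF y N that] by simp
  qed
  have score: "\<bar>\<Sum>j=1..N. p k j * \<alpha> j\<bar> \<le> c"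
    if "mle_feasible N y L c \<alpha> \<beta> \<gamma>" "k \<in> {1..K}" for \<alpha> \<beta> \<gamma> k
    unfolding p_def y_def N_def
    by (rule abs_prob_diff_score_le[OF S(1) supp_W supp_Y])
      (use that range[OF that(1)] in \<open>simp_all add: N_def\<close>)
  \<comment> \<open>The lotteries are supported on the breakpoints, so the score at the true node
    values is exactly the logit of the response, free of interpolation error.\<close>
  have s_eq: "s k = (measure_pmf.expectation (W k) u - measure_pmf.expectation (Y k) u) / \<sigma>"
    if "k \<in> {1..K}" for k
    using sum_pmf_nth_point[OF S(1) supp_W[OF that], of u] sum_pmf_nth_point[OF S(1) supp_Y[OF that], of u]
    by (simp add: s_def p_def \<theta>_def prob_diff_def N_def y_def left_diff_distrib sum_subtractf
        diff_divide_distrib sum_divide_distrib[symmetric])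
  obtain J where J: "J \<subseteq> {2..N}" "card J \<le> R"
    and span_J: "\<And>j. j \<in> {2..N} \<Longrightarrow> \<exists>c. \<forall>k\<in>{1..K}. p k j = (\<Sum>l\<in>J. c l * p k l)"
    by (rule design_columns_in_span_of_rank_many[OF \<open>1 \<le> K\<close>, of N p, folded R_def]) (rule that)
  have "finite J"
    using J(1) finite_subset by blast
  from orthonormal_spanning_family[OF this, of "{1..K}" "\<lambda>j k. p k j"]
  obtain r e where r: "r \<le> card J"
    and orth: "\<And>i j. i < r \<Longrightarrow> j < r \<Longrightarrow> (\<Sum>k=1..K. e i k * e j k) = of_bool (i = j)"
    and span_e: "\<And>j k. j \<in> J \<Longrightarrow> k \<in> {1..K} \<Longrightarrow> p k j = (\<Sum>i<r. (\<Sum>l=1..K. e i l * p l j) * e i k)"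
    by blast
  \<comment> \<open>Projection is linear, so the expansion passes from the columns in
    \<open>J\<close> to their combinations, that is to all columns.\<close>
  have span: "p k j = (\<Sum>i<r. (\<Sum>l=1..K. e i l * p l j) * e i k)" if jk: "j \<in> {2..N}" "k \<in> {1..K}" for j k
  proof -
    obtain a where a: "\<And>k. k \<in> {1..K} \<Longrightarrow> p k j = (\<Sum>l\<in>J. a l * p k l)"
      using span_J[OF jk(1)] by blast
    have "p k j = (\<Sum>i<r. (\<Sum>l=1..K. e i l * (\<Sum>j\<in>J. a j * p l j)) * e i k)"
      unfolding a[OF jk(2)]
      by (rule sum_projection_expansion[where v = "\<lambda>j k. p k j"]) (rule span_e[OF _ jk(2)])
    also have "\<dots> = (\<Sum>i<r. (\<Sum>l=1..K. e i l * p l j) * e i k)"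
      using a by (intro sum.cong refl arg_cong2[where f = "(*)"]) simp_all
    finally show ?thesis .
  qed
  define Q where "Q z = (\<Sum>i<r. (\<Sum>k=1..K. e i k * (z k / (1 + exp (z k * s k))))\<^sup>2)" for z
  have "0 < w"
    by (simp add: w_def add_pos_pos)
  have "0 \<le> - ln \<delta>"
    using \<open>0 < \<delta>\<close> \<open>\<delta> < 1\<close> by simp
  have "0 \<le> real R * (- ln \<delta>)"
    using \<open>0 \<le> - ln \<delta>\<close> by (intro mult_nonneg_nonneg) auto
  then have "T / (w\<^sup>2 * real K) \<le> A"
    unfolding A_def T_def using \<open>0 < w\<close> by (intro divide_right_mono) auto
  moreover have "0 \<le> T / (w\<^sup>2 * real K)"
    unfolding T_def using \<open>0 \<le> - ln \<delta>\<close> by (intro divide_nonneg_nonneg) auto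
  ultimately have A: "T / (w\<^sup>2 * real K) \<le> A" "0 \<le> A"
    by auto
  have "0 \<le> B"
    using \<open>0 < lam\<close> by (simp add: B_def)
  have "0 < m"
    unfolding m_def using min_eigenvalue_regularized_Sigma_D(1)[OF \<open>1 \<le> K\<close> N] \<open>0 < lam\<close>
    by (rule less_le_trans[rotated])
  \<comment> \<open>Randomness enters only through \<open>Q z \<le> T\<close>; for a fixed response
    pattern the rest is deterministic.\<close>
  have deterministic: "d_K N y (scaled_u_MLE N y \<alpha> \<gamma>) (\<lambda>t. u t / \<sigma>) \<le> bound"
    if z: "z \<in> {1..K} \<rightarrow>\<^sub>E {-1, 1}" and "Q z \<le> T" and opt: "mle_optimal K N y p L c z \<alpha> \<beta> \<gamma>"
    for z \<alpha> \<beta> \<gamma>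
    unfolding bound_def
  proof (rule d_K_le_mesh_plus_node_error[OF y N y_ends \<open>u \<in> _\<close> \<sigma>])
    show "0 \<le> L"
      using \<open>0 < L\<close> by simp
    show feas: "mle_feasible N y L c \<alpha> \<beta> \<gamma>"
      using opt by (simp add: mle_optimal_def is_arg_max_def)
    fix j assume j: "j \<in> {1..N}"
    have le: "log_likelihood K N p z \<theta> \<le> log_likelihood K N p z \<alpha>"
      using opt \<theta>_feasible unfolding mle_optimal_def is_arg_max_def by (auto simp: not_less)
    have first: "\<alpha> 1 = 0" "\<theta> 1 = 0"
      using feas \<theta>_feasible by (auto simp: mle_feasible_def)
    have z': "z k \<in> {-1, 1}" if "k \<in> {1..K}" for k
      using z that by (rule PiE_mem)
    have "\<bar>\<alpha> j - \<theta> j\<bar> \<le> sqrt (4 * (T / (w\<^sup>2 * real K)) + B) / sqrt m"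
      unfolding w_def B_def m_def
      by (rule mle_node_error[OF \<open>0 < c\<close> \<open>1 \<le> K\<close> N \<open>0 < lam\<close> range[OF feas] range[OF \<theta>_feasible]
            first score[OF feas] score[OF \<theta>_feasible] z' le orth span \<open>Q z \<le> T\<close>[unfolded Q_def s_def] j])
    also have "\<dots> \<le> sqrt (4 * A + B) / sqrt m"
      using A \<open>0 < m\<close> by (intro divide_right_mono real_sqrt_le_mono) auto
    also have "\<dots> \<le> (sqrt A + sqrt (A + B)) / sqrt m"
      using sqrt_add_sqrt_ge[OF A(2) \<open>0 \<le> B\<close>] \<open>0 < m\<close> by (intro divide_right_mono) auto
    finally show "\<bar>\<alpha> j - u (y j) / \<sigma>\<bar> \<le> (sqrt A + sqrt (A + B)) / sqrt m"
      by (simp add: \<theta>_def)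
  qed
  define good where "good z \<longleftrightarrow> (\<forall>\<alpha> \<beta> \<gamma>. mle_optimal K N y p L c z \<alpha> \<beta> \<gamma> \<longrightarrow>
    d_K N y (scaled_u_MLE N y \<alpha> \<gamma>) (\<lambda>t. u t / \<sigma>) \<le> bound)" for z
  define Z where "Z = {1..K} \<rightarrow>\<^sub>E {-1, 1 :: real}"
  define X where "X k x = response u W Y \<epsilon> x k" for k x
  have X_Z: "(\<lambda>k\<in>{1..K}. X k x) \<in> Z" for x
    by (auto simp: Z_def X_def response_def)
  \<comment> \<open>The likelihood reads responses only on \<open>{1..K}\<close>, so the restricted
    pattern, an element of \<open>Z\<close>, has the same maximisers.\<close>
  have "log_likelihood K N p (\<lambda>k\<in>{1..K}. X k x) = log_likelihood K N p (response u W Y \<epsilon> x)" for x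
    by (intro ext) (simp add: log_likelihood_def X_def)
  then have good_restrict: "good (response u W Y \<epsilon> x) \<longleftrightarrow> good (\<lambda>k\<in>{1..K}. X k x)" for x
    by (simp add: good_def mle_optimal_def)
  have indep: "indep_vars (\<lambda>_. borel) X {1..K}"
    unfolding X_def by (rule response_indep_vars) fact
  have "{1..K} \<noteq> {}"
    using \<open>1 \<le> K\<close> by simp
  note finite_valued = finite_valued_indep_vars[OF indep this finite_atLeastAtMost, of "{-1, 1}"]
  define G where "G = {x \<in> space M. (\<lambda>k\<in>{1..K}. X k x) \<in> {z \<in> Z. good z}}"
  define D where "D = {x \<in> space M. (\<lambda>k\<in>{1..K}. X k x) \<in> {z \<in> Z. T < Q z}}"
  have G: "G \<in> events" and D: "D \<in> events"
    unfolding G_def D_def by (rule finite_valued(1); force simp: Z_def)+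
  have "prob D = (\<Sum>z\<in>{z \<in> Z. T < Q z}. \<Prod>k\<in>{1..K}. prob {x \<in> space M. X k x = z k})"
    unfolding D_def by (rule finite_valued(2)) (auto simp: Z_def)
  also have "\<dots> = (\<Sum>z\<in>{z \<in> Z. T < Q z}. \<Prod>k\<in>{1..K}. 1 / (1 + exp (- z k * s k)))"
  proof (intro sum.cong prod.cong refl)
    fix z k assume z: "z \<in> {z \<in> Z. T < Q z}" and k: "k \<in> {1..K}"
    have "z k \<in> {-1, 1}"
      using z k unfolding Z_def by blast
    then show "prob {x \<in> space M. X k x = z k} = 1 / (1 + exp (- z k * s k))"
      unfolding X_def s_eq[OF k] using assms(11) k \<sigma>(1)
      by (intro prob_response[OF assms(10)]) auto
  qed
  also have "\<dots> \<le> exp (- 2 * - ln \<delta>)"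
    using centered_bernoulli_projection_tail[where s = s and t = "- ln \<delta>",
        OF finite_atLeastAtMost orth order_trans[OF r J(2)]]
    unfolding Z_def T_def Q_def by simp
  \<comment> \<open>The tail bound gives \<open>\<delta>\<^sup>2\<close>, which is below
    \<open>\<delta>\<close>.\<close>
  also have "\<dots> \<le> exp (ln \<delta>)"
    using \<open>0 \<le> - ln \<delta>\<close> by simp
  finally have D_le: "prob D \<le> \<delta>"
    using \<open>0 < \<delta>\<close> by simp
  have compl: "space M - G \<subseteq> D"
  proof
    fix x assume "x \<in> space M - G"
    then have x: "x \<in> space M" "\<not> good (\<lambda>k\<in>{1..K}. X k x)"
      using X_Z by (auto simp: G_def)
    then have "T < Q (\<lambda>k\<in>{1..K}. X k x)"
      using deterministic[OF X_Z[unfolded Z_def], of x] not_le unfolding good_def by blast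
    then show "x \<in> D"
      using x X_Z by (simp add: D_def)
  qed
  have "prob (space M - G) \<le> \<delta>"
    using finite_measure_mono[OF compl D] D_le by linarith
  then have "1 - \<delta> \<le> prob G"
    using prob_compl[OF G] by linarith
  moreover have "G = {x \<in> space M. good (response u W Y \<epsilon> x)}"
    using X_Z by (auto simp: G_def good_restrict)
  ultimately have "1 - \<delta> \<le> prob {x \<in> space M. good (response u W Y \<epsilon> x)}"
    by simp
  then show ?thesis
    unfolding good_def bound_def m_def B_def A_def w_def R_def p_def y_def N_def S_def Let_def .
qed

end
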